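(* Let $(H,\ell_H)\in\mathcal{G}_{or(n)}$ be self-$\hat\gamma$ via $\mu$, where $\hat\gamma\in\mathfrak{S}^n$ and $\mu\in S_n$, and let $(G,\ell_G)\in Orb(H,\ell_H)$ with $(\hat\alpha,\pi)(H,\ell_H)=(G,\ell_G)$, where $(\hat\alpha,\pi)\in\mathfrak{S}^n\rtimes S_n$. Then $(G,\ell_G)$ is self-$\hat\gamma'$ via $\mu'$, where $$\hat\gamma'=\hat\alpha\cdot\hat\gamma\pi^{-1}\cdot\hat\alpha^{-1}\pi\mu^{-1}\pi^{-1}\qquad\text{and}\qquad \mu'=\pi\mu\pi^{-1}.$$
   Context: **Ribbon graphs.** A (finite) ribbon graph $G=(V(G),E(G))$ is a surface with boundary presented as the union of a set $V(G)$ of discs (vertices) and a set $E(G)$ of discs (edges) such that vertices and edges intersect in disjoint line segments, each such segment lies on the boundary of precisely one vertex and precisely one edge, and every edge contains exactly two such segments. Two ribbon graphs are isomorphic if there is a homeomorphism (not required to preserve any orientation) taking vertices to vertices and edges to edges; equivalently, if the corresponding cellularly embedded graphs are isomorphic. **Arrow presentations.** A ribbon graph is encoded by drawing each vertex boundary as a circle and recording, for each edge $e$, two directed arcs (arrows) labelled $e$ on the circles, namely the two segments where $e$ meets vertices, directed by an arbitrary orientation of the boundary of the disc $e$. **Operations on one edge.** Let $A,B$ be the two arrows labelled $e$. The partial Petrial (twist) $\tau$ at $e$ reverses the direction of exactly one of $A,B$. The partial dual $\delta$ at $e$: draw a segment with an arrow on it labelled $e$ directed from the head of $A$ to the tail of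 $B$, and another with an arrow labelled $e$ directed from the head of $B$ to the tail of $A$; then delete $A$, $B$ and the arcs containing them. Vertices may change; the set of edges (labels) is unchanged. It is known that the group $\mathfrak{S} = \langle \delta,\tau \mid \delta^2,\tau^2,(\tau\delta)^3\rangle \cong S_3$ thereby acts on the left on any fixed edge (in a product the rightmost factor is applied first), and operations on distinct edges commute. **Ordered graphs.** $[n]=\{1,\dots,n\}$. $\mathcal{G}_{or(n)}$ is the set of isomorphism classes of pairs $(G,\ell)$, where $G$ is a ribbon graph with exactly $n$ edges ($n\ge 1$) and $\ell\colon[n]\to E(G)$ is a bijection (a linear ordering of the edges). $(G,\ell_G)$ and $(H,\ell_H)$ are isomorphic if there is a ribbon graph isomorphism $G\to H$ whose edge bijection $g$ satisfies $g\circ\ell_G=\ell_H$. **Group action.** An element $\hat\gamma\in\mathfrak{S}^n$ is regarded as a map $[n]\to\mathfrak{S}$; multiplication (written $\cdot$) and inversion in $\mathfrak{S}^n$ are entrywise, and $\hat\gamma\pi$, for $\pi\in S_n$, is composition of maps (composition with permutations binds tighter than $\cdot$; $\hat\alpha^{-1}\sigma$ is the entrywise inverse of $\hat\alpha$ composed with $\sigma$). $G^{\Gamma(\hat\gamma,\ell)}$ denotes the ribbon graph obtained from $G$ by applying to each edge $e$ the operation $\hat\gamma(\ell^{-1}(e))$. The group $\mathfrak{S}^n\rtimes S_n$, with multiplication $(\hat\gamma_1,\pi_1)(\hat\gamma_2,\pi_2)=(\hat\gamma_1\cdot\hat\gamma_2\pi_1^{-1},\pi_1\pi_2)$, acts on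 $\mathcal{G}_{or(n)}$ by $(\hat\gamma,\pi)(G,\ell)=(G^{\Gamma(\hat\gamma,\ell\pi^{-1})},\ell\pi^{-1})$. $Orb(H,\ell_H)$ is the orbit of $(H,\ell_H)$ under $\mathfrak{S}^n\rtimes S_n$. **Self-$\hat\gamma$.** $(G,\ell)$ is self-$\hat\gamma$ via $\mu\in S_n$ if $(\hat\gamma,\mu)(G,\ell)=(G,\ell)$ in $\mathcal{G}_{or(n)}$. *)

theory Defs
  imports "HOL-Analysis.Analysis" "HOL-Algebra.Product_Groups" "HOL-Algebra.Group_Action"
begin

section \<open>Ribbon graphs\<close>

record 'a ribbon =
  surf :: "'a topology"
  verts :: "'a set set"
  edges :: "'a set set"

definition surface_with_boundary :: "'a topology \<Rightarrow> bool" where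
  "surface_with_boundary X \<longleftrightarrow> Hausdorff_space X \<and> second_countable X \<and>
     (\<forall>x\<in>topspace X. \<exists>U W. openin X U \<and> x \<in> U \<and>
        openin (top_of_set {z :: complex. 0 \<le> Im z}) W \<and>
        subtopology X U homeomorphic_space top_of_set W)"

definition disc_in :: "'a topology \<Rightarrow> 'a set \<Rightarrow> bool" where
  "disc_in X d \<longleftrightarrow> d \<subseteq> topspace X \<and>
     subtopology X d homeomorphic_space top_of_set (cball (0 :: complex) 1)"

text \<open>The boundary circle of a disc; by invariance of domain it does not depend on
  the choice of the homeomorphism with the closed unit disc.\<close>

definition bd :: "'a topology \<Rightarrow> 'a set \<Rightarrow> 'a set" where
  "bd X d = {x. \<exists>f. homeomorphic_map (top_of_set (cball (0 :: complex) 1)) (subtopology X d) f \<and>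
                    x \<in> f ` sphere 0 1}"

definition segments :: "'a ribbon \<Rightarrow> 'a set set" where
  "segments G = (\<Union>v\<in>verts G. \<Union>e\<in>edges G.
     connected_components_of (subtopology (surf G) (v \<inter> e)))"

definition ribbon_graph :: "'a ribbon \<Rightarrow> bool" where
  "ribbon_graph G \<longleftrightarrow>
     surface_with_boundary (surf G) \<and>
     topspace (surf G) = \<Union>(verts G) \<union> \<Union>(edges G) \<and>
     finite (verts G) \<and> finite (edges G) \<and>
     (\<forall>d\<in>verts G \<union> edges G. disc_in (surf G) d) \<and>
     disjoint (verts G) \<and> disjoint (edges G) \<and>
     (\<forall>s\<in>segments G. subtopology (surf G) s homeomorphic_space top_of_set {0..1 :: real}) \<and>
     disjoint (segments G) \<and>
     (\<forall>s\<in>segments G. (\<exists>!v. v \<in> verts G \<and> s \<subseteq> bd (surf G) v) \<and>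
                      (\<exists>!e. e \<in> edges G \<and> s \<subseteq> bd (surf G) e)) \<and>
     (\<forall>e\<in>edges G. card {s \<in> segments G. s \<subseteq> e} = 2)"

definition ribbon_iso :: "'a ribbon \<Rightarrow> 'a ribbon \<Rightarrow> ('a \<Rightarrow> 'a) \<Rightarrow> bool" where
  "ribbon_iso G H f \<longleftrightarrow> homeomorphic_map (surf G) (surf H) f \<and>
     (`) f ` verts G = verts H \<and> (`) f ` edges G = edges H"

section \<open>Arrow presentations\<close>

text \<open>
  An arrow presentation is a family of circles carrying labelled arrows, two for every label.
  It is recorded as the space \<open>rest\<close> left over from the circles when the interiors of all arrows
  are removed (a disjoint union of arcs, and of one circle for every circle without arrows),
  together with, for every label, the set of its two arrows, an arrow being the pair
  (tail, head) of points of \<open>rest\<close>.  The circles are recovered by drawing a segment from the tail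
  to the head of every arrow.  The operations below redraw arrows between the same end points
  and never touch \<open>rest\<close>.
\<close>

record ('p, 'e) arrow_presentation =
  rest :: "'p topology"
  labels :: "'e set"
  arrows :: "'e \<Rightarrow> ('p \<times> 'p) set"

definition ap_iso ::
  "('e \<Rightarrow> 'f) \<Rightarrow> ('p, 'e) arrow_presentation \<Rightarrow> ('q, 'f) arrow_presentation \<Rightarrow> bool" where
  "ap_iso g P Q \<longleftrightarrow> bij_betw g (labels P) (labels Q) \<and>
     (\<exists>f. homeomorphic_map (rest P) (rest Q) f \<and>
          (\<forall>e\<in>labels P. arrows Q (g e) = map_prod f f ` arrows P e))"

text \<open>An orientation of the boundary of a disc is given by a parametrization by the unit circle;
  an arc of the boundary is directed by running through it counterclockwise.\<close>

definition orientation :: "'a topology \<Rightarrow> 'a set \<Rightarrow> (complex \<Rightarrow> 'a) \<Rightarrow> bool" where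
  "orientation X d \<phi> \<longleftrightarrow> homeomorphic_map (top_of_set (sphere 0 1)) (subtopology X (bd X d)) \<phi>"

definition directed :: "(complex \<Rightarrow> 'a) \<Rightarrow> 'a set \<Rightarrow> 'a \<Rightarrow> 'a \<Rightarrow> bool" where
  "directed \<phi> s t h \<longleftrightarrow> (\<exists>a b :: real. a < b \<and> b < a + 2 * pi \<and>
     s = \<phi> ` cis ` {a..b} \<and> t = \<phi> (cis a) \<and> h = \<phi> (cis b))"

definition seg_ends :: "'a topology \<Rightarrow> 'a set \<Rightarrow> 'a set" where
  "seg_ends X s =
     {x. \<exists>f. homeomorphic_map (top_of_set {0..1 :: real}) (subtopology X s) f \<and> x = f 0}"

text \<open>The arrow presentation of a ribbon graph for a choice \<open>\<phi>\<close> of orientations of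
  the boundaries of its edges.\<close>

definition orientations :: "'a ribbon \<Rightarrow> ('a set \<Rightarrow> complex \<Rightarrow> 'a) \<Rightarrow> bool" where
  "orientations G \<phi> \<longleftrightarrow> (\<forall>e\<in>edges G. orientation (surf G) e (\<phi> e))"

definition presentation ::
  "'a ribbon \<Rightarrow> ('a set \<Rightarrow> complex \<Rightarrow> 'a) \<Rightarrow> ('a, 'a set) arrow_presentation" where
  "presentation G \<phi> =
     \<lparr> rest = subtopology (surf G)
         ((\<Union>v\<in>verts G. bd (surf G) v) - (\<Union>s\<in>segments G. s - seg_ends (surf G) s)),
       labels = edges G,
       arrows = (\<lambda>e. {(t, h). \<exists>s\<in>segments G. s \<subseteq> e \<and> directed (\<phi> e) s t h}) \<rparr>"

section \<open>The group generated by partial duality and partial Petriality\<close>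

datatype twual = Delta | Tau

text \<open>The congruence on words given by the relators. As both generators are involutions, the
  quotient monoid is the group with this presentation.\<close>

inductive word_eq :: "twual list \<Rightarrow> twual list \<Rightarrow> bool" where
  refl: "word_eq u u"
| sym: "word_eq u v \<Longrightarrow> word_eq v u"
| trans: "word_eq u v \<Longrightarrow> word_eq v w \<Longrightarrow> word_eq u w"
| append: "word_eq u u' \<Longrightarrow> word_eq v v' \<Longrightarrow> word_eq (u @ v) (u' @ v')"
| delta: "word_eq [Delta, Delta] []"
| tau: "word_eq [Tau, Tau] []"
| tau_delta: "word_eq [Tau, Delta, Tau, Delta, Tau, Delta] []"

definition twuality :: "twual list set monoid" where
  "twuality =
     \<lparr> carrier = UNIV // {(u, v). word_eq u v},
       monoid.mult = (\<lambda>A B. {w. \<exists>u\<in>A. \<exists>v\<in>B. word_eq w (u @ v)}),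
       one = {w. word_eq w []} \<rparr>"

text \<open>The effect of the generators on the set of the two arrows \<open>(tail, head)\<close> of an edge.
  For \<open>Tau\<close> there are two outcomes, which differ by reversing both arrows, that is, by the
  choice of an orientation of the edge.\<close>

fun twual_step :: "twual \<Rightarrow> ('p \<times> 'p) set \<Rightarrow> ('p \<times> 'p) set \<Rightarrow> bool" where
  "twual_step Delta S T \<longleftrightarrow> T = {(snd A, fst B) | A B. A \<in> S \<and> B \<in> S \<and> A \<noteq> B}"
| "twual_step Tau S T \<longleftrightarrow> (\<exists>A\<in>S. T = insert (prod.swap A) (S - {A}))"

fun twual_word :: "twual list \<Rightarrow> ('p \<times> 'p) set \<Rightarrow> ('p \<times> 'p) set \<Rightarrow> bool" where
  "twual_word [] S T \<longleftrightarrow> T = S"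
| "twual_word (x # w) S T \<longleftrightarrow> (\<exists>S'. twual_word w S S' \<and> twual_step x S' T)"

text \<open>Elements of \<^term>\<open>twuality\<close> are classes of words, so \<open>w \<in> c\<close> says that \<open>w\<close> represents \<open>c\<close>.
  Up to reversing both arrows, the outcome does not depend on \<open>w\<close>.\<close>

definition apply_ops ::
  "('e \<Rightarrow> twual list set) \<Rightarrow> ('p, 'e) arrow_presentation \<Rightarrow> ('p, 'e) arrow_presentation \<Rightarrow> bool" where
  "apply_ops \<Gamma> P Q \<longleftrightarrow> rest Q = rest P \<and> labels Q = labels P \<and>
     (\<forall>e\<in>labels P. \<exists>w\<in>\<Gamma> e. twual_word w (arrows P e) (arrows Q e))"

text \<open>\<open>K\<close> is obtained from \<open>G\<close> by applying the operation \<open>\<Gamma> e\<close> to every edge \<open>e\<close>, and \<open>g e\<close>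
  is the edge of \<open>K\<close> with the same label as \<open>e\<close>. This determines \<open>K\<close> and \<open>g\<close> up to isomorphism.\<close>

definition twisted_dual ::
  "('a set \<Rightarrow> twual list set) \<Rightarrow> 'a ribbon \<Rightarrow> 'a ribbon \<Rightarrow> ('a set \<Rightarrow> 'a set) \<Rightarrow> bool" where
  "twisted_dual \<Gamma> G K g \<longleftrightarrow>
     (\<exists>\<phi> \<psi> Q. orientations G \<phi> \<and> orientations K \<psi> \<and>
        apply_ops \<Gamma> (presentation G \<phi>) Q \<and> ap_iso g Q (presentation K \<psi>))"

section \<open>Ordered ribbon graphs and the group action\<close>

definition ordered_graphs :: "nat \<Rightarrow> ('a ribbon \<times> (nat \<Rightarrow> 'a set)) set" where
  "ordered_graphs n = {(G, l). ribbon_graph G \<and> bij_betw l {1..n} (edges G)}"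

definition ordered_iso :: "nat \<Rightarrow> ('a ribbon \<times> (nat \<Rightarrow> 'a set)) rel" where
  "ordered_iso n = {((G, l), (H, m)).
     (G, l) \<in> ordered_graphs n \<and> (H, m) \<in> ordered_graphs n \<and>
     (\<exists>f. ribbon_iso G H f \<and> (\<forall>i\<in>{1..n}. f ` l i = m i))}"

definition G_or :: "nat \<Rightarrow> ('a ribbon \<times> (nat \<Rightarrow> 'a set)) set set" where
  "G_or n = ordered_graphs n // ordered_iso n"

definition iso_class ::
  "nat \<Rightarrow> 'a ribbon \<Rightarrow> (nat \<Rightarrow> 'a set) \<Rightarrow> ('a ribbon \<times> (nat \<Rightarrow> 'a set)) set" where
  "iso_class n G l = ordered_iso n `` {(G, l)}"

abbreviation twuality_pow :: "nat \<Rightarrow> (nat \<Rightarrow> twual list set) monoid" where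
  "twuality_pow n \<equiv> product_group {1..n} (\<lambda>_. twuality)"

definition ordered_group :: "nat \<Rightarrow> ((nat \<Rightarrow> twual list set) \<times> (nat \<Rightarrow> nat)) monoid" where
  "ordered_group n =
     \<lparr> carrier = carrier (twuality_pow n) \<times> {\<pi>. \<pi> permutes {1..n}},
       monoid.mult = (\<lambda>(\<gamma>\<^sub>1, \<pi>\<^sub>1) (\<gamma>\<^sub>2, \<pi>\<^sub>2).
         (\<gamma>\<^sub>1 \<otimes>\<^bsub>twuality_pow n\<^esub> (\<gamma>\<^sub>2 \<circ> inv_into UNIV \<pi>\<^sub>1), \<pi>\<^sub>1 \<circ> \<pi>\<^sub>2)),
       one = (\<one>\<^bsub>twuality_pow n\<^esub>, id) \<rparr>"

definition act ::
  "nat \<Rightarrow> (nat \<Rightarrow> twual list set) \<times> (nat \<Rightarrow> nat) \<Rightarrow>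
   ('a ribbon \<times> (nat \<Rightarrow> 'a set)) set \<Rightarrow> ('a ribbon \<times> (nat \<Rightarrow> 'a set)) set" where
  "act n = (\<lambda>(\<gamma>, \<pi>) C. {(K, k). (K, k) \<in> ordered_graphs n \<and>
     (\<exists>(G, l)\<in>C. \<exists>g.
        twisted_dual (\<lambda>e. \<gamma> (inv_into {1..n} (l \<circ> inv_into UNIV \<pi>) e)) G K g \<and>
        (\<forall>i\<in>{1..n}. k i = g ((l \<circ> inv_into UNIV \<pi>) i)))})"

definition self_via ::
  "nat \<Rightarrow> 'a ribbon \<Rightarrow> (nat \<Rightarrow> 'a set) \<Rightarrow> (nat \<Rightarrow> twual list set) \<Rightarrow> (nat \<Rightarrow> nat) \<Rightarrow> bool" where
  "self_via n G l \<gamma> \<mu> \<longleftrightarrow> act n (\<gamma>, \<mu>) (iso_class n G l) = iso_class n G l"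

end

theory Submission
  imports Defs
begin

text \<open>
  In the semidirect product, \<open>(\<gamma>', \<mu>') = (\<alpha>, \<pi>) (\<gamma>, \<mu>) (\<alpha>, \<pi>)\<inverse>\<close>, so the theorem is the
  familiar fact that the stabilizer of a translated point is the conjugate stabilizer. The work
  lies in showing that twisted duality, which is defined through surfaces, choices of
  orientations and words in the generators, composes and inverts like a group action.

  The action is set-valued: \<open>act\<close> collects all ribbon graphs that realize the twisted arrow
  presentation. It is therefore handled through the relation
  \<open>twist_related n c (G, l) (K, k)\<close>, which says that applying the class \<open>c i\<close> to the edge
  \<open>l i\<close> of \<open>G\<close> for every \<open>i\<close> yields \<open>K\<close>, with \<open>k i\<close> as the \<open>i\<close>-th edge. Four closure
  properties carry the proof: relations by \<open>c\<close> and then by \<open>d\<close> compose to one by the pointwise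
  product \<open>d \<cdot> c\<close>, inverting \<open>c\<close> reverses the relation, permuting the labels is harmless, and
  an ordered isomorphism is a relation by the identity class (lemmas \<open>twist_related_trans\<close>,
  \<open>twist_related_inv\<close>, \<open>twist_related_permute\<close>, \<open>twist_related_one_if_iso\<close>). Both inclusions of
  the theorem are then walks along such relations. Every intermediate graph on these walks is
  supplied by one of the two hypotheses on \<open>H\<close>: since the image of the class of \<open>H\<close> under
  \<open>(\<gamma>, \<mu>)\<close> is that class again, \<open>H\<close> itself serves as a \<open>\<gamma>\<close>-twist of a copy of \<open>H\<close>, and no
  ribbon graph has to be built from an arrow presentation.

  Two facts make composition possible although each relation brings its own orientations of the
  edges. Topologically, two orientations of an edge agree on all arcs or are opposite on all arcs
  (\<open>orientations_agree_or_opposite\<close>), so the arrows of an edge are determined up to reversing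
  both. Algebraically, \<open>Tau Tau\<close> can be carried out so that it reverses both arrows; as the word
  \<open>[Tau, Tau]\<close> represents the identity, a class of words absorbs such a reversal
  (\<open>class_acts_swap\<close>). Reversibility of the generators needs that the two arrows of an edge have
  four distinct end points, which holds because the two segments of an edge are disjoint arcs
  (\<open>two_arrows_edge_arrows\<close>).
\<close>

section \<open>The group of classes of words\<close>

definition word_class :: "twual list \<Rightarrow> twual list set" where
  "word_class u = {w. word_eq w u}"

lemma word_class_eq_iff: "word_class u = word_class v \<longleftrightarrow> word_eq u v"
  unfolding word_class_def using word_eq.refl word_eq.sym word_eq.trans by blast

lemma word_class_self: "w \<in> word_class w"
  by (simp add: word_class_def word_eq.refl)

lemma carrier_twuality: "carrier twuality = range word_class"
proof -
  have "{(u, v). word_eq u v} `` {u} = word_class u" for u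
    unfolding word_class_def using word_eq.sym by blast
  then show ?thesis
    unfolding twuality_def quotient_def by auto
qed

lemma in_carrier_twualityD:
  assumes "c \<in> carrier twuality" "w \<in> c"
  shows "c = word_class w"
  using assms unfolding carrier_twuality word_class_def
  using word_eq.sym word_eq.trans by blast

lemma word_class_mult: "word_class u \<otimes>\<^bsub>twuality\<^esub> word_class v = word_class (u @ v)"
  unfolding twuality_def word_class_def
  by (auto intro: word_eq.refl word_eq.trans word_eq.append)

lemma one_twuality: "\<one>\<^bsub>twuality\<^esub> = word_class []"
  by (simp add: twuality_def word_class_def)

lemma word_eq_rev_cancel: "word_eq (rev u @ u) []"
proof (induction u)
  case Nil
  show ?case by (simp add: word_eq.refl)
next
  case (Cons x u)
  have "word_eq [x, x] []"
    by (cases x) (auto intro: word_eq.delta word_eq.tau)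
  then have "word_eq (rev u @ [x, x] @ u) (rev u @ [] @ u)"
    by (intro word_eq.append word_eq.refl)
  with Cons show ?case
    using word_eq.trans by auto
qed

text \<open>Inverses come from reversing words, because both generators are involutions.\<close>

lemma group_twuality: "group twuality"
proof (rule groupI)
  fix x y z
  assume "x \<in> carrier twuality" "y \<in> carrier twuality" "z \<in> carrier twuality"
  then show "x \<otimes>\<^bsub>twuality\<^esub> y \<otimes>\<^bsub>twuality\<^esub> z = x \<otimes>\<^bsub>twuality\<^esub> (y \<otimes>\<^bsub>twuality\<^esub> z)"
    by (auto simp: carrier_twuality word_class_mult)
next
  fix x
  assume "x \<in> carrier twuality"
  then obtain u where "x = word_class u"
    by (auto simp: carrier_twuality)
  then have "word_class (rev u) \<otimes>\<^bsub>twuality\<^esub> x = \<one>\<^bsub>twuality\<^esub>"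
    by (simp add: word_class_mult one_twuality word_class_eq_iff word_eq_rev_cancel)
  then show "\<exists>y\<in>carrier twuality. y \<otimes>\<^bsub>twuality\<^esub> x = \<one>\<^bsub>twuality\<^esub>"
    by (auto simp: carrier_twuality)
qed (auto simp: carrier_twuality word_class_mult one_twuality)

lemma inv_word_class: "inv\<^bsub>twuality\<^esub> (word_class w) = word_class (rev w)"
proof (rule group.inv_equality[OF group_twuality])
  show "word_class (rev w) \<otimes>\<^bsub>twuality\<^esub> word_class w = \<one>\<^bsub>twuality\<^esub>"
    by (simp add: word_class_mult one_twuality word_class_eq_iff word_eq_rev_cancel)
qed (auto simp: carrier_twuality)

section \<open>Operations on the two arrows of an edge\<close>

text \<open>The configurations on which the generators are reversible: were two of the four end points
  equal, a twist could merge the two arrows into one.\<close>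

definition two_arrows :: "'p set \<Rightarrow> ('p \<times> 'p) set \<Rightarrow> bool" where
  "two_arrows V S \<longleftrightarrow>
     (\<exists>a b c d. S = {(a, b), (c, d)} \<and> distinct [a, b, c, d] \<and> {a, b, c, d} \<subseteq> V)"

lemma two_arrowsI:
  assumes "distinct [a, b, c, d]" "{a, b, c, d} \<subseteq> V"
  shows "two_arrows V {(a, b), (c, d)}"
  unfolding two_arrows_def by (intro exI conjI) (rule HOL.refl, fact+)

lemma two_arrowsE:
  assumes "two_arrows V S"
  obtains a b c d
  where "S = {(a, b), (c, d)}" "distinct [a, b, c, d]" "{a, b, c, d} \<subseteq> V"
  using assms unfolding two_arrows_def by (elim exE conjE)

lemma distinct4_map:
  assumes "distinct [a, b, c, d]" "{a, b, c, d} \<subseteq> V" "inj_on f V"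
  shows "distinct [f a, f b, f c, f d]"
  using assms by (simp add: inj_on_eq_iff)

lemma two_arrows_imp_subset: "two_arrows V S \<Longrightarrow> S \<subseteq> V \<times> V"
  by (elim two_arrowsE) simp

lemma two_arrows_card: "two_arrows V S \<Longrightarrow> finite S \<and> card S = 2"
  by (elim two_arrowsE) simp

lemma two_arrows_swap:
  assumes "two_arrows V S"
  shows "two_arrows V (prod.swap ` S)"
  using assms
proof (rule two_arrowsE)
  fix a b c d
  assume "S = {(a, b), (c, d)}" "distinct [a, b, c, d]" "{a, b, c, d} \<subseteq> V"
  then show ?thesis
    using two_arrowsI[of b a d c V] by (simp add: eq_commute)
qed

lemma twual_step_Delta_two:
  assumes "distinct [a, b, c, d]"
  shows "twual_step Delta {(a, b), (c, d)} T \<longleftrightarrow> T = {(b, c), (d, a)}"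
proof -
  have "(a, b) \<noteq> (c, d)"
    using assms by simp
  then have "{(snd A, fst B) | A B. A \<in> {(a, b), (c, d)} \<and> B \<in> {(a, b), (c, d)} \<and> A \<noteq> B}
      = {(snd (a, b), fst (c, d)), (snd (c, d), fst (a, b))}"
    by blast
  then show ?thesis by simp
qed

lemma twual_step_Tau_two:
  assumes "distinct [a, b, c, d]"
  shows "twual_step Tau {(a, b), (c, d)} T \<longleftrightarrow> T = {(b, a), (c, d)} \<or> T = {(a, b), (d, c)}"
proof -
  have "{(a, b), (c, d)} - {(a, b)} = {(c, d)}" "{(a, b), (c, d)} - {(c, d)} = {(a, b)}"
    using assms by auto
  then show ?thesis by (simp add: insert_commute)
qed

text \<open>A step can be undone by a step of the same kind: \<open>Delta\<close> is an involution, and among the two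
  outcomes of repeating \<open>Tau\<close> one untwists the arrow that was twisted.\<close>

lemma twual_step_two_arrows:
  assumes "two_arrows V S" "twual_step x S T"
  shows "two_arrows V T \<and> twual_step x T S"
  using assms(1)
proof (rule two_arrowsE)
  fix a b c d
  assume S: "S = {(a, b), (c, d)}" and dist: "distinct [a, b, c, d]" and V: "{a, b, c, d} \<subseteq> V"
  show ?thesis
  proof (cases x)
    case Delta
    then have T: "T = {(b, c), (d, a)}"
      using assms(2) twual_step_Delta_two[OF dist] unfolding S by blast
    have dist': "distinct [b, c, d, a]"
      using dist by (simp add: eq_commute)
    have "two_arrows V T"
      unfolding T using V by (intro two_arrowsI dist') simp
    moreover have "twual_step Delta T S"
      unfolding T twual_step_Delta_two[OF dist'] S by (rule insert_commute)
    ultimately show ?thesis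
      unfolding Delta by blast
  next
    case Tau
    then consider "T = {(b, a), (c, d)}" | "T = {(a, b), (d, c)}"
      using assms(2) twual_step_Tau_two[OF dist] unfolding S by blast
    then show ?thesis
    proof cases
      case 1
      have dist': "distinct [b, a, c, d]"
        using dist by (simp add: eq_commute)
      have "two_arrows V T"
        unfolding 1 using V by (intro two_arrowsI dist') simp
      moreover have "twual_step Tau T S"
        unfolding 1 twual_step_Tau_two[OF dist'] S by (rule disjI1) (rule HOL.refl)
      ultimately show ?thesis
        unfolding Tau by blast
    next
      case 2
      have dist': "distinct [a, b, d, c]"
        using dist by (simp add: eq_commute)
      have "two_arrows V T"
        unfolding 2 using V by (intro two_arrowsI dist') simp
      moreover have "twual_step Tau T S"
        unfolding 2 twual_step_Tau_two[OF dist'] S by (rule disjI2) (rule HOL.refl)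
      ultimately show ?thesis
        unfolding Tau by blast
    qed
  qed
qed

lemma twual_step_map:
  assumes "two_arrows V S" "inj_on f V" "twual_step x S T"
  shows "twual_step x (map_prod f f ` S) (map_prod f f ` T)"
  using assms(1)
proof (rule two_arrowsE)
  fix a b c d
  assume S: "S = {(a, b), (c, d)}" and dist: "distinct [a, b, c, d]" and V: "{a, b, c, d} \<subseteq> V"
  note dist' = distinct4_map[OF dist V assms(2)]
  have fS: "map_prod f f ` S = {(f a, f b), (f c, f d)}"
    by (simp add: S)
  show ?thesis
  proof (cases x)
    case Delta
    then have "T = {(b, c), (d, a)}"
      using assms(3) twual_step_Delta_two[OF dist] unfolding S by blast
    then show ?thesis
      unfolding fS Delta twual_step_Delta_two[OF dist'] by simp
  next
    case Tau
    then have "T = {(b, a), (c, d)} \<or> T = {(a, b), (d, c)}"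
      using assms(3) twual_step_Tau_two[OF dist] unfolding S by blast
    then show ?thesis
      unfolding fS Tau twual_step_Tau_two[OF dist'] by (elim disjE) simp_all
  qed
qed

lemma twual_word_append:
  "twual_word (u @ v) S U \<longleftrightarrow> (\<exists>T. twual_word v S T \<and> twual_word u T U)"
  by (induction u arbitrary: U) auto

lemma twual_word_two_arrows:
  assumes "two_arrows V S" "twual_word w S T"
  shows "two_arrows V T"
  using assms by (induction w arbitrary: T) (auto dest: twual_step_two_arrows)

lemma twual_word_rev:
  assumes "two_arrows V S" "twual_word w S T"
  shows "twual_word (rev w) T S"
  using assms(2)
proof (induction w arbitrary: T)
  case (Cons x w)
  then obtain S' where S': "twual_word w S S'" "twual_step x S' T"
    by auto
  moreover have "twual_step x T S'"
    using S' twual_word_two_arrows[OF assms(1)] twual_step_two_arrows by blast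
  ultimately show ?case
    using Cons.IH by (auto simp: twual_word_append)
qed simp

lemma twual_word_map:
  assumes "two_arrows V S" "inj_on f V" "twual_word w S T"
  shows "twual_word w (map_prod f f ` S) (map_prod f f ` T)"
  using assms(3)
proof (induction w arbitrary: T)
  case (Cons x w)
  then obtain S' where "twual_word w S S'" "twual_step x S' T"
    by auto
  then show ?case
    using Cons.IH twual_step_map[OF twual_word_two_arrows[OF assms(1)] assms(2)]
    unfolding twual_word.simps by blast
qed simp

text \<open>The two applications of \<open>Tau\<close> may choose different arrows. This is how the identity class
  comes to contain the reversal of both arrows.\<close>

lemma Tau_Tau_swap:
  assumes "two_arrows V S"
  shows "twual_word [Tau, Tau] S (prod.swap ` S)"
  using assms
proof (rule two_arrowsE)
  fix a b c d
  assume S: "S = {(a, b), (c, d)}" and dist: "distinct [a, b, c, d]"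
  have dist': "distinct [b, a, c, d]"
    using dist by (simp add: eq_commute)
  have "twual_step Tau S {(b, a), (c, d)}"
    unfolding S twual_step_Tau_two[OF dist] by (rule disjI1) (rule HOL.refl)
  moreover have "twual_step Tau {(b, a), (c, d)} (prod.swap ` S)"
    unfolding twual_step_Tau_two[OF dist'] S by (rule disjI2) simp
  ultimately show ?thesis
    unfolding twual_word.simps by blast
qed

definition class_acts :: "twual list set \<Rightarrow> ('p \<times> 'p) set \<Rightarrow> ('p \<times> 'p) set \<Rightarrow> bool" where
  "class_acts c S T \<longleftrightarrow> (\<exists>w\<in>c. twual_word w S T)"

lemma class_acts_two_arrows: "two_arrows V S \<Longrightarrow> class_acts c S T \<Longrightarrow> two_arrows V T"
  by (auto simp: class_acts_def intro: twual_word_two_arrows)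

lemma class_acts_one: "class_acts \<one>\<^bsub>twuality\<^esub> S S"
  unfolding class_acts_def one_twuality by (rule bexI[OF _ word_class_self]) simp

lemma class_acts_mult:
  assumes "class_acts c S T" "class_acts d T U"
  shows "class_acts (d \<otimes>\<^bsub>twuality\<^esub> c) S U"
proof -
  from assms obtain v u where "v \<in> c" "twual_word v S T" "u \<in> d" "twual_word u T U"
    by (auto simp: class_acts_def)
  then have "twual_word (u @ v) S U" "u @ v \<in> d \<otimes>\<^bsub>twuality\<^esub> c"
    by (auto simp: twual_word_append twuality_def intro: word_eq.refl)
  then show ?thesis
    by (auto simp: class_acts_def)
qed

lemma class_acts_inv:
  assumes "c \<in> carrier twuality" "two_arrows V S" "class_acts c S T"
  shows "class_acts (inv\<^bsub>twuality\<^esub> c) T S"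
proof -
  from assms(3) obtain w where w: "w \<in> c" "twual_word w S T"
    by (auto simp: class_acts_def)
  then have "inv\<^bsub>twuality\<^esub> c = word_class (rev w)"
    using in_carrier_twualityD[OF assms(1)] inv_word_class by metis
  then show ?thesis
    using twual_word_rev[OF assms(2) w(2)] word_class_self by (auto simp: class_acts_def)
qed

lemma class_acts_map:
  assumes "two_arrows V S" "inj_on f V" "class_acts c S T"
  shows "class_acts c (map_prod f f ` S) (map_prod f f ` T)"
  using assms twual_word_map unfolding class_acts_def by blast

text \<open>The start of an operation matters only up to reversing both arrows: prefixing the operation by
  the word \<open>[Tau, Tau]\<close> undoes the reversal without leaving the class. This makes the outcome
  independent of the orientation of the edge.\<close>

lemma class_acts_swap:
  assumes "c \<in> carrier twuality" "two_arrows V S" "class_acts c S T"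
  shows "class_acts c (prod.swap ` S) T"
proof -
  from assms(3) obtain w where w: "w \<in> c" "twual_word w S T"
    by (auto simp: class_acts_def)
  have "twual_word [Tau, Tau] (prod.swap ` S) S"
    using Tau_Tau_swap[OF two_arrows_swap[OF assms(2)]] by (simp add: image_comp del: twual_word.simps)
  then have "twual_word (w @ [Tau, Tau]) (prod.swap ` S) T"
    using w(2) twual_word_append by blast
  moreover have "word_eq (w @ [Tau, Tau]) (w @ [])"
    by (intro word_eq.append word_eq.refl word_eq.tau)
  then have "w @ [Tau, Tau] \<in> c"
    using in_carrier_twualityD[OF assms(1) w(1)] by (simp add: word_class_def)
  ultimately show ?thesis
    by (auto simp: class_acts_def simp del: twual_word.simps)
qed

section \<open>Arcs of the circle\<close>

text \<open>A path in the circle has a continuous angle, obtained as the imaginary part of a continuous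
  logarithm. Both topological facts below are read off from such angles.\<close>

lemma circle_lift:
  fixes p :: "real \<Rightarrow> complex"
  assumes "convex S" "continuous_on S p" "p ` S \<subseteq> sphere 0 1"
  obtains \<theta> where "continuous_on S \<theta>" "\<And>x. x \<in> S \<Longrightarrow> p x = cis (\<theta> x)"
proof -
  have norm: "norm (p x) = 1" if "x \<in> S" for x
    using assms(3) that by auto
  then have "p x \<noteq> 0" if "x \<in> S" for x
    using that by force
  then obtain g where g: "continuous_on S g" "\<And>x. x \<in> S \<Longrightarrow> p x = exp (g x)"
    using continuous_logarithm_on_contractible[OF assms(2) convex_imp_contractible[OF assms(1)]]
    by metis
  have "p x = cis (Im (g x))" if "x \<in> S" for x
    using norm[OF that] g(2)[OF that] exp_eq_polar[of "g x"] by (simp add: norm_mult)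
  moreover have "continuous_on S (\<lambda>x. Im (g x))"
    using g(1) by (intro continuous_intros)
  ultimately show thesis
    using that by blast
qed

lemma cis_eq_imp_eq:
  assumes "cis x = cis y" "\<bar>x - y\<bar> < 2 * pi"
  shows "x = y"
proof -
  have "sin x = sin y \<and> cos x = cos y"
    using assms(1) by (simp add: complex_eq_iff)
  then obtain k :: int where k: "x = y + 2 * pi * k"
    using sin_cos_eq_iff by blast
  with assms(2) have "2 * pi * \<bar>real_of_int k\<bar> < 2 * pi * 1"
    by (simp add: abs_mult)
  then have "\<bar>real_of_int k\<bar> < 1"
    by (rule mult_left_less_imp_less) simp
  then have "k = 0" by linarith
  with k show ?thesis by simp
qed

text \<open>The starting point can be recovered from an arc as a set: it is the only point of the arc
  from which every small clockwise move leaves the arc.\<close>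

lemma arc_start_unique:
  assumes "a < b" "b < a + 2 * pi" "a' < b'" "b' < a' + 2 * pi"
    and eq: "cis ` {a..b} = cis ` {a'..b'}"
  shows "cis a = cis a'"
proof -
  have "cis a \<in> cis ` {a'..b'}"
    using assms(1) unfolding eq[symmetric] by auto
  then obtain x where x: "x \<in> {a'..b'}" "cis a = cis x"
    by auto
  show ?thesis
  proof (cases "x = a'")
    case False
    \<comment> \<open>A clockwise move by this angle stays in the second arc but leaves the first.\<close>
    define \<epsilon> where "\<epsilon> = min (x - a') (a + 2 * pi - b) / 2"
    have \<epsilon>: "0 < \<epsilon>" "\<epsilon> \<le> x - a'" "\<epsilon> < a + 2 * pi - b"
      using False x(1) assms(2) by (auto simp: \<epsilon>_def min_def)
    have "cis (x - \<epsilon>) \<in> cis ` {a..b}"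
      unfolding eq using \<epsilon> x(1) by auto
    then obtain y where y: "y \<in> {a..b}" "cis y = cis (x - \<epsilon>)"
      by auto
    have "cis (x - \<epsilon>) = cis (a - \<epsilon>)"
      using x(2) by (simp add: cis_divide[symmetric])
    then have "y = a - \<epsilon>"
      using y \<epsilon> by (intro cis_eq_imp_eq) auto
    with y(1) \<epsilon>(1) show ?thesis by simp
  qed (use x in simp)
qed

text \<open>Complex conjugation exchanges starting points and end points.\<close>

lemma arc_end_unique:
  assumes "a < b" "b < a + 2 * pi" "a' < b'" "b' < a' + 2 * pi"
    and eq: "cis ` {a..b} = cis ` {a'..b'}"
  shows "cis b = cis b'"
proof -
  have refl: "cis ` {- v..- u} = cnj ` cis ` {u..v}" for u v :: real
  proof -
    have "{- v..- u} = uminus ` {u..v}" by simp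
    then show ?thesis by (simp add: image_comp comp_def cis_cnj del: image_uminus_atLeastAtMost)
  qed
  have "cis (- b) = cis (- b')"
    using assms(1-4) by (intro arc_start_unique[of _ "- a" _ "- a'"]) (simp_all add: refl eq)
  then show ?thesis by (simp flip: cis_cnj)
qed

lemma directed_unique:
  assumes "inj_on \<phi> (sphere 0 1)" "directed \<phi> s t h" "directed \<phi> s t' h'"
  shows "t' = t \<and> h' = h"
proof -
  from assms(2,3) obtain a b a' b' where
    a: "a < b" "b < a + 2 * pi" "s = \<phi> ` cis ` {a..b}" "t = \<phi> (cis a)" "h = \<phi> (cis b)" and
    a': "a' < b'" "b' < a' + 2 * pi" "s = \<phi> ` cis ` {a'..b'}" "t' = \<phi> (cis a')" "h' = \<phi> (cis b')"
    unfolding directed_def by blast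
  have "\<phi> ` cis ` {a..b} = \<phi> ` cis ` {a'..b'}"
    using a(3) a'(3) by simp
  then have "cis ` {a..b} = cis ` {a'..b'}"
    by (subst (asm) inj_on_image_eq_iff[OF assms(1)]) auto
  then show ?thesis
    using arc_start_unique arc_end_unique a a' by metis
qed

lemma directed_ends:
  assumes "inj_on \<phi> (sphere 0 1)" "directed \<phi> s t h"
  shows "t \<in> s" "h \<in> s" "t \<noteq> h"
proof -
  from assms(2) obtain a b where
    a: "a < b" "b < a + 2 * pi" "s = \<phi> ` cis ` {a..b}" "t = \<phi> (cis a)" "h = \<phi> (cis b)"
    unfolding directed_def by blast
  then show "t \<in> s" "h \<in> s" by auto
  have "cis a \<noteq> cis b"
    using a cis_eq_imp_eq[of a b] by auto
  then show "t \<noteq> h"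
    using assms(1) a by (auto dest: inj_onD)
qed

section \<open>Orientations of edges\<close>

lemma bd_subset: "bd X d \<subseteq> topspace X \<inter> d"
proof
  fix x
  assume "x \<in> bd X d"
  then obtain f where f: "homeomorphic_map (top_of_set (cball (0 :: complex) 1)) (subtopology X d) f"
    "x \<in> f ` sphere 0 1"
    unfolding bd_def by blast
  then have "f ` cball 0 1 = topspace X \<inter> d"
    using homeomorphic_imp_surjective_map[OF f(1)] by simp
  with f(2) show "x \<in> topspace X \<inter> d" by auto
qed

lemma orientation_facts:
  assumes "orientation X d \<phi>"
  shows "inj_on \<phi> (sphere 0 1)" "\<phi> ` sphere 0 1 = bd X d"
    "continuous_map (top_of_set (sphere 0 1)) X \<phi>"
proof -
  have hom: "homeomorphic_map (top_of_set (sphere 0 1)) (subtopology X (bd X d)) \<phi>"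
    using assms by (simp add: orientation_def)
  show "inj_on \<phi> (sphere 0 1)"
    using homeomorphic_imp_injective_map[OF hom] by simp
  show "\<phi> ` sphere 0 1 = bd X d"
    using homeomorphic_imp_surjective_map[OF hom] bd_subset[of X d] by (simp add: Int_absorb1)
  show "continuous_map (top_of_set (sphere 0 1)) X \<phi>"
    using homeomorphic_imp_continuous_map[OF hom] by (simp add: continuous_map_in_subtopology)
qed

lemma orientation_inverse:
  assumes "orientation X d \<phi>"
  obtains \<rho> where "continuous_map (subtopology X (bd X d)) (top_of_set (sphere 0 1)) \<rho>"
    "\<And>x. x \<in> bd X d \<Longrightarrow> \<rho> x \<in> sphere 0 1 \<and> \<phi> (\<rho> x) = x"
proof -
  from assms obtain \<rho> where \<rho>:
    "homeomorphic_maps (top_of_set (sphere 0 1)) (subtopology X (bd X d)) \<phi> \<rho>"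
    by (auto simp: orientation_def homeomorphic_map_maps)
  have top: "topspace (subtopology X (bd X d)) = bd X d"
    using bd_subset[of X d] by auto
  have "\<rho> x \<in> sphere 0 1 \<and> \<phi> (\<rho> x) = x" if "x \<in> bd X d" for x
    using \<rho> that top unfolding homeomorphic_maps_def continuous_map_def by fastforce
  then show thesis
    using that \<rho> unfolding homeomorphic_maps_def by blast
qed

text \<open>A segment on the boundary of a disc is a counterclockwise arc: parametrize it by the unit
  interval and lift to angles. The lift is injective, so the angles fill an interval, which is
  shorter than a full turn as \<open>cis\<close> is injective on it.\<close>

lemma directed_exists:
  assumes or: "orientation X d \<phi>" and s: "s \<subseteq> bd X d"
    and seg: "subtopology X s homeomorphic_space top_of_set {0..1 :: real}"
  shows "\<exists>t h. directed \<phi> s t h"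
proof -
  obtain \<rho> where \<rho>: "continuous_map (subtopology X (bd X d)) (top_of_set (sphere 0 1)) \<rho>"
    "\<And>x. x \<in> bd X d \<Longrightarrow> \<rho> x \<in> sphere 0 1 \<and> \<phi> (\<rho> x) = x"
    using orientation_inverse[OF or] by blast
  obtain k where k: "homeomorphic_map (top_of_set {0..1 :: real}) (subtopology X s) k"
    using seg homeomorphic_space homeomorphic_space_sym by blast
  have ks: "k ` {0..1} = s"
    using homeomorphic_imp_surjective_map[OF k] s bd_subset[of X d] by auto
  have injk: "inj_on k {0..1}"
    using homeomorphic_imp_injective_map[OF k] by simp
  have "continuous_map (top_of_set {0..1}) (subtopology X (bd X d)) k"
    using homeomorphic_imp_continuous_map[OF k] ks s
    by (auto simp: continuous_map_in_subtopology)
  then have "continuous_map (top_of_set {0..1}) (top_of_set (sphere 0 1)) (\<rho> \<circ> k)"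
    using \<rho>(1) by (rule continuous_map_compose)
  then have "continuous_on {0..1} (\<rho> \<circ> k)" "(\<rho> \<circ> k) ` {0..1} \<subseteq> sphere 0 1"
    by auto
  then obtain \<theta> where \<theta>: "continuous_on {0..1} \<theta>" "\<And>x. x \<in> {0..1} \<Longrightarrow> (\<rho> \<circ> k) x = cis (\<theta> x)"
    using circle_lift[of "{0..1}" "\<rho> \<circ> k"] by auto
  have k\<theta>: "k x = \<phi> (cis (\<theta> x))" if "x \<in> {0..1}" for x
  proof -
    have "k x \<in> bd X d"
      using ks s that by blast
    then show ?thesis
      using \<rho>(2)[of "k x"] \<theta>(2)[OF that] by simp
  qed
  obtain a b where ab: "\<theta> ` {0..1} = {a..b}" "a \<le> b"
    using continuous_image_closed_interval[OF _ \<theta>(1)] by auto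
  have inj: "x = y" if "x \<in> {a..b}" "y \<in> {a..b}" "cis x = cis y" for x y
  proof -
    from that ab(1) obtain u v where "u \<in> {0..1}" "v \<in> {0..1}" "x = \<theta> u" "y = \<theta> v"
      by (metis imageE)
    then show ?thesis
      using that(3) k\<theta> injk by (metis inj_onD)
  qed
  have "a \<noteq> b"
  proof
    assume "a = b"
    then have "\<theta> 0 = \<theta> 1"
      using ab(1) by (metis atLeastAtMost_iff atLeastAtMost_singleton image_eqI order_refl
          singletonD zero_le_one)
    then have "k 0 = k 1"
      by (simp add: k\<theta>)
    then show False
      using injk by (auto dest: inj_onD)
  qed
  moreover have "b < a + 2 * pi"
  proof (rule ccontr)
    assume "\<not> b < a + 2 * pi"
    then have "a = a + 2 * pi"
      using ab(2) by (intro inj) (auto simp flip: cis_mult)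
    then show False by simp
  qed
  moreover have "s = \<phi> ` cis ` {a..b}"
    using k\<theta> by (auto simp: ks[symmetric] ab(1)[symmetric] image_comp)
  ultimately show ?thesis
    using ab(2) unfolding directed_def by (intro exI[of _ "\<phi> (cis a)"] exI[of _ "\<phi> (cis b)"] exI[of _ a] exI[of _ b]) auto
qed

lemma directed_seg_ends:
  assumes "Hausdorff_space X" "orientation X d \<phi>" "directed \<phi> s t h"
  shows "t \<in> seg_ends X s" "h \<in> seg_ends X s"
proof -
  from assms(3) obtain a b where
    a: "a < b" "b < a + 2 * pi" "s = \<phi> ` cis ` {a..b}" "t = \<phi> (cis a)" "h = \<phi> (cis b)"
    unfolding directed_def by blast
  note \<phi> = orientation_facts[OF assms(2)]
  have end_in: "\<phi> (cis c) \<in> seg_ends X s"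
    if cm: "c \<noteq> m" "(\<lambda>u. (m - c) * u + c) ` {0..1} = {a..b}" for c m
  proof -
    let ?r = "\<lambda>u :: real. (m - c) * u + c"
    have im: "(\<lambda>u. \<phi> (cis (?r u))) ` {0..1} = s"
      unfolding a(3) cm(2)[symmetric] by (simp add: image_comp comp_def)
    have "continuous_map (top_of_set {0..1}) (top_of_set (sphere 0 1)) (\<lambda>u. cis (?r u))"
      by (auto intro!: continuous_intros)
    from continuous_map_compose[OF this \<phi>(3)]
    have "continuous_map (top_of_set {0..1}) (subtopology X s) (\<lambda>u. \<phi> (cis (?r u)))"
      using im by (auto simp: continuous_map_in_subtopology comp_def)
    moreover have "inj_on (\<lambda>u. \<phi> (cis (?r u))) {0..1}"
    proof (rule inj_onI)
      fix u v :: real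
      assume uv: "u \<in> {0..1}" "v \<in> {0..1}" "\<phi> (cis (?r u)) = \<phi> (cis (?r v))"
      then have "cis (?r u) = cis (?r v)"
        using \<phi>(1) by (auto dest: inj_onD)
      moreover have "?r u \<in> {a..b}" "?r v \<in> {a..b}"
        using uv cm(2) by blast+
      then have "\<bar>?r u - ?r v\<bar> < 2 * pi"
        using a by auto
      ultimately have "?r u = ?r v"
        by (rule cis_eq_imp_eq)
      then show "u = v"
        using cm(1) by simp
    qed
    moreover have "s \<subseteq> topspace X"
      using a(3) \<phi>(2) bd_subset[of X d] by auto
    ultimately have "homeomorphic_map (top_of_set {0..1}) (subtopology X s) (\<lambda>u. \<phi> (cis (?r u)))"
      using im assms(1)
      by (intro continuous_imp_homeomorphic_map)
        (auto simp: compact_space_subtopology Hausdorff_space_subtopology)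
    then show ?thesis
      unfolding seg_ends_def by (intro CollectI exI[of _ "\<lambda>u. \<phi> (cis (?r u))"]) simp
  qed
  have "(\<lambda>u. (b - a) * u + a) ` {0..1} = {a..b}"
    using a(1) by (simp add: image_affinity_atLeastAtMost)
  then show "t \<in> seg_ends X s"
    unfolding a(4) using a(1) by (intro end_in) auto
  have "(\<lambda>u. (a - b) * u + b) ` {0..1} = {a..b}"
    using a(1) by (simp add: image_affinity_atLeastAtMost)
  then show "h \<in> seg_ends X s"
    unfolding a(5) using a(1) by (intro end_in) auto
qed

text \<open>The change of orientation is an injective map of the circle to itself; let \<open>\<theta>\<close> be its angle.
  The difference \<open>\<theta> (x + y) - \<theta> x\<close> cannot vanish for \<open>y\<close> strictly between \<open>0\<close> and a full turn.
  These pairs \<open>(x, y)\<close> form a connected set, so the difference has one sign throughout, and this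
  sign decides between the two cases for all arcs at once.\<close>

lemma orientations_agree_or_opposite:
  assumes \<phi>: "orientation X d \<phi>" and \<psi>: "orientation X d \<psi>"
  shows "(\<forall>s t h. directed \<psi> s t h \<longrightarrow> directed \<phi> s t h) \<or>
         (\<forall>s t h. directed \<psi> s t h \<longrightarrow> directed \<phi> s h t)"
proof -
  obtain \<rho> where \<rho>: "continuous_map (subtopology X (bd X d)) (top_of_set (sphere 0 1)) \<rho>"
    "\<And>x. x \<in> bd X d \<Longrightarrow> \<rho> x \<in> sphere 0 1 \<and> \<phi> (\<rho> x) = x"
    using orientation_inverse[OF \<phi>] by blast
  note f\<psi> = orientation_facts[OF \<psi>]
  have "continuous_map (top_of_set (sphere 0 1)) (subtopology X (bd X d)) \<psi>"
    using \<psi> unfolding orientation_def by (rule homeomorphic_imp_continuous_map)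
  from continuous_map_compose[OF this \<rho>(1)]
  have "continuous_on (sphere 0 1) (\<rho> \<circ> \<psi>)"
    by auto
  then have "continuous_on UNIV (\<lambda>x. (\<rho> \<circ> \<psi>) (cis x))"
    by (rule continuous_on_compose2) (auto intro!: continuous_intros)
  moreover have "(\<lambda>x. (\<rho> \<circ> \<psi>) (cis x)) ` UNIV \<subseteq> sphere 0 1"
    using \<rho>(2) f\<psi>(2) by force
  ultimately obtain \<theta> where \<theta>: "continuous_on UNIV \<theta>" "\<And>x. (\<rho> \<circ> \<psi>) (cis x) = cis (\<theta> x)"
    using circle_lift[of UNIV "\<lambda>x. (\<rho> \<circ> \<psi>) (cis x)"] by auto
  have \<psi>\<phi>: "\<psi> (cis x) = \<phi> (cis (\<theta> x))" for x
  proof -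
    have "\<psi> (cis x) \<in> bd X d"
      using f\<psi>(2) by auto
    then show ?thesis
      using \<rho>(2) \<theta>(2)[of x] by (metis comp_apply)
  qed
  have inj: "x = y" if "\<bar>x - y\<bar> < 2 * pi" "cis (\<theta> x) = cis (\<theta> y)" for x y
  proof -
    have "\<psi> (cis x) = \<psi> (cis y)"
      by (simp add: \<psi>\<phi> that(2))
    then have "cis x = cis y"
      using f\<psi>(1) by (auto dest: inj_onD)
    then show ?thesis
      using that(1) by (rule cis_eq_imp_eq)
  qed
  define D where "D = (\<lambda>(x, y). \<theta> (x + y) - \<theta> x)"
  define W where "W = (UNIV :: real set) \<times> {0<..<2 * pi}"
  have "continuous_on W D"
    unfolding D_def case_prod_beta
    by (intro continuous_intros continuous_on_compose2[OF \<theta>(1)]) auto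
  moreover have "connected W"
    unfolding W_def by (intro convex_connected convex_Times) auto
  ultimately have conn: "connected (D ` W)"
    by (rule connected_continuous_image)
  have "0 \<notin> D ` W"
  proof
    assume "0 \<in> D ` W"
    then obtain x y where "y \<in> {0<..<2 * pi}" "\<theta> (x + y) = \<theta> x"
      by (auto simp: D_def W_def)
    then show False
      using inj[of "x + y" x] by auto
  qed
  then have sign: "(\<forall>z\<in>D ` W. 0 < z) \<or> (\<forall>z\<in>D ` W. z < 0)"
    using conn by (metis connectedD_interval linorder_cases less_imp_le)
  have D_arc: "D (x, y - x) \<in> D ` W" if "x < y" "y < x + 2 * pi" for x y
    using that by (intro imageI) (auto simp: W_def)
  have inside: "\<exists>z\<in>{a..b}. \<theta> z = w"
    if "a < b" "w \<in> closed_segment (\<theta> a) (\<theta> b)" for a b w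
    using that IVT'_closed_segment_real[of w \<theta> a b] continuous_on_subset[OF \<theta>(1)]
    by (auto simp: closed_segment_eq_real_ivl)
  have incr: "\<theta> ` {a..b} = closed_segment (\<theta> a) (\<theta> b) \<and> \<bar>\<theta> b - \<theta> a\<bar> < 2 * pi"
    if ab: "a < b" "b < a + 2 * pi" for a b
  proof
    show "\<theta> ` {a..b} = closed_segment (\<theta> a) (\<theta> b)"
    proof
      show "closed_segment (\<theta> a) (\<theta> b) \<subseteq> \<theta> ` {a..b}"
        using inside[OF ab(1)] by blast
      show "\<theta> ` {a..b} \<subseteq> closed_segment (\<theta> a) (\<theta> b)"
      proof clarify
        fix x assume x: "x \<in> {a..b}"
        show "\<theta> x \<in> closed_segment (\<theta> a) (\<theta> b)"
        proof (cases "x = a \<or> x = b")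
          case False
          then have "D (a, x - a) \<in> D ` W" "D (x, b - x) \<in> D ` W"
            using x ab by (auto intro!: D_arc)
          then show ?thesis
            using sign by (fastforce simp: D_def closed_segment_eq_real_ivl)
        qed auto
      qed
    qed
    \<comment> \<open>Otherwise the intermediate value theorem yields a second angle with the image of \<open>a\<close>.\<close>
    show "\<bar>\<theta> b - \<theta> a\<bar> < 2 * pi"
    proof (rule ccontr)
      assume "\<not> \<bar>\<theta> b - \<theta> a\<bar> < 2 * pi"
      then have "\<exists>w\<in>closed_segment (\<theta> a) (\<theta> b). cis w = cis (\<theta> a) \<and> w \<noteq> \<theta> a"
        by (intro bexI[of _ "if \<theta> a \<le> \<theta> b then \<theta> a + 2 * pi else \<theta> a - 2 * pi"])
          (auto simp: closed_segment_eq_real_ivl cis_mult[symmetric] cis_divide[symmetric])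
      then obtain z where "z \<in> {a..b}" "cis (\<theta> z) = cis (\<theta> a)" "\<theta> z \<noteq> \<theta> a"
        using inside[OF ab(1)] by metis
      then show False
        using inj[of z a] ab by auto
    qed
  qed
  have arc: "\<psi> ` cis ` A = \<phi> ` cis ` \<theta> ` A" for A
    by (simp add: image_comp comp_def \<psi>\<phi>)
  from sign show ?thesis
  proof (elim disjE)
    assume pos: "\<forall>z\<in>D ` W. 0 < z"
    have "directed \<phi> s t h" if "directed \<psi> s t h" for s t h
    proof -
      from that obtain a b where
        a: "a < b" "b < a + 2 * pi" "s = \<psi> ` cis ` {a..b}" "t = \<psi> (cis a)" "h = \<psi> (cis b)"
        unfolding directed_def by blast
      have "\<theta> a < \<theta> b"
        using D_arc[OF a(1,2)] pos by (auto simp: D_def)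
      then show ?thesis
        unfolding directed_def using a incr[OF a(1,2)]
        by (intro exI[of _ "\<theta> a"] exI[of _ "\<theta> b"])
          (auto simp: \<psi>\<phi> arc closed_segment_eq_real_ivl)
    qed
    then show ?thesis by blast
  next
    assume neg: "\<forall>z\<in>D ` W. z < 0"
    have "directed \<phi> s h t" if "directed \<psi> s t h" for s t h
    proof -
      from that obtain a b where
        a: "a < b" "b < a + 2 * pi" "s = \<psi> ` cis ` {a..b}" "t = \<psi> (cis a)" "h = \<psi> (cis b)"
        unfolding directed_def by blast
      have "\<theta> b < \<theta> a"
        using D_arc[OF a(1,2)] neg by (auto simp: D_def)
      then show ?thesis
        unfolding directed_def using a incr[OF a(1,2)]
        by (intro exI[of _ "\<theta> b"] exI[of _ "\<theta> a"])
          (auto simp: \<psi>\<phi> arc closed_segment_eq_real_ivl)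
    qed
    then show ?thesis by blast
  qed
qed

section \<open>The arrows of an edge\<close>

lemma homeomorphic_map_inverseE:
  assumes "homeomorphic_map X Y f"
  obtains g where "homeomorphic_map Y X g"
    "\<forall>x\<in>topspace X. g (f x) = x" "\<forall>y\<in>topspace Y. f (g y) = y"
proof -
  from assms obtain g where "homeomorphic_maps X Y f g"
    unfolding homeomorphic_map_maps by blast
  then show thesis
    using that by (subst (asm) homeomorphic_maps_map) blast
qed

lemma segments_nonempty:
  assumes "s \<in> segments G"
  shows "s \<noteq> {}" "s \<subseteq> topspace (surf G)"
proof -
  from assms obtain v e where
    s: "s \<in> connected_components_of (subtopology (surf G) (v \<inter> e))"
    unfolding segments_def by blast
  show "s \<noteq> {}"
    using s by (rule nonempty_connected_components_of)
  show "s \<subseteq> topspace (surf G)"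
    using connected_components_of_subset[OF s] by auto
qed

lemma ribbon_graphD:
  assumes "ribbon_graph G"
  shows "Hausdorff_space (surf G)"
    and "d \<in> verts G \<union> edges G \<Longrightarrow> d \<subseteq> topspace (surf G)"
    and "disjoint (edges G)" "disjoint (segments G)"
    and "s \<in> segments G \<Longrightarrow> subtopology (surf G) s homeomorphic_space top_of_set {0..1 :: real}"
    and "s \<in> segments G \<Longrightarrow> \<exists>v\<in>verts G. s \<subseteq> bd (surf G) v"
    and "s \<in> segments G \<Longrightarrow> \<exists>e\<in>edges G. s \<subseteq> bd (surf G) e"
    and "e \<in> edges G \<Longrightarrow> card {s \<in> segments G. s \<subseteq> e} = 2"
proof -
  have D: "Hausdorff_space (surf G)"
    "\<forall>d\<in>verts G \<union> edges G. disc_in (surf G) d"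
    "disjoint (edges G)" "disjoint (segments G)"
    "\<forall>s\<in>segments G. subtopology (surf G) s homeomorphic_space top_of_set {0..1 :: real}"
    "\<forall>s\<in>segments G. (\<exists>!v. v \<in> verts G \<and> s \<subseteq> bd (surf G) v) \<and>
                    (\<exists>!e. e \<in> edges G \<and> s \<subseteq> bd (surf G) e)"
    "\<forall>e\<in>edges G. card {s \<in> segments G. s \<subseteq> e} = 2"
    using assms unfolding ribbon_graph_def surface_with_boundary_def by - (elim conjE, assumption)+
  show "Hausdorff_space (surf G)" "disjoint (edges G)" "disjoint (segments G)"
    by (fact D)+
  show "d \<in> verts G \<union> edges G \<Longrightarrow> d \<subseteq> topspace (surf G)"
    using D(2) unfolding disc_in_def by blast
  show "s \<in> segments G \<Longrightarrow> subtopology (surf G) s homeomorphic_space top_of_set {0..1 :: real}"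
    by (rule D(5)[rule_format])
  show "\<exists>v\<in>verts G. s \<subseteq> bd (surf G) v" if "s \<in> segments G"
    using D(6)[rule_format, OF that] unfolding Bex_def by (elim conjE) (rule ex1_implies_ex)
  show "\<exists>e\<in>edges G. s \<subseteq> bd (surf G) e" if "s \<in> segments G"
    using D(6)[rule_format, OF that] unfolding Bex_def by (elim conjE) (rule ex1_implies_ex)
  show "e \<in> edges G \<Longrightarrow> card {s \<in> segments G. s \<subseteq> e} = 2"
    by (rule D(7)[rule_format])
qed

lemma segment_subset_bd_edge:
  assumes "ribbon_graph G" "s \<in> segments G" "e \<in> edges G" "s \<subseteq> e"
  shows "s \<subseteq> bd (surf G) e"
proof -
  obtain e' where e': "e' \<in> edges G" "s \<subseteq> bd (surf G) e'"
    using ribbon_graphD(7)[OF assms(1,2)] by blast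
  then have "s \<subseteq> e'"
    using bd_subset by fastforce
  then have "\<not> disjnt e e'"
    using assms(4) segments_nonempty(1)[OF assms(2)] by (auto simp: disjnt_def)
  then have "e' = e"
    using ribbon_graphD(3)[OF assms(1)] assms(3) e'(1) by (metis pairwiseD)
  with e'(2) show ?thesis by simp
qed

text \<open>Components of \<^const>\<open>presentation\<close>. The rest space does not mention the orientations, so all
  arrow presentations of a ribbon graph share it.\<close>

abbreviation rest_space :: "'a ribbon \<Rightarrow> 'a topology" where
  "rest_space G \<equiv> subtopology (surf G)
     ((\<Union>v\<in>verts G. bd (surf G) v) - (\<Union>s\<in>segments G. s - seg_ends (surf G) s))"

abbreviation edge_arrows :: "'a ribbon \<Rightarrow> ('a set \<Rightarrow> complex \<Rightarrow> 'a) \<Rightarrow> 'a set \<Rightarrow> ('a \<times> 'a) set" where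
  "edge_arrows G \<phi> e \<equiv> {(t, h). \<exists>s\<in>segments G. s \<subseteq> e \<and> directed (\<phi> e) s t h}"

text \<open>The two segments of the edge are disjoint arcs, each with exactly one direction. Their end points
  survive in the rest space: each segment lies on the boundary of a vertex, it keeps its own end
  points when its interior is removed, and it is disjoint from all other segments.\<close>

lemma two_arrows_edge_arrows:
  assumes G: "ribbon_graph G" and or: "orientations G \<phi>" and e: "e \<in> edges G"
  shows "two_arrows (topspace (rest_space G)) (edge_arrows G \<phi> e)"
proof -
  have or_e: "orientation (surf G) e (\<phi> e)"
    using or e by (simp add: orientations_def)
  note inj = orientation_facts(1)[OF or_e]
  have disj: "disjoint (segments G)"
    by (rule ribbon_graphD(4)[OF G])
  have in_rest: "x \<in> topspace (rest_space G)" if s: "s \<in> segments G" and x: "x \<in> s" "x \<in> seg_ends (surf G) s" for x s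
  proof -
    obtain v where "v \<in> verts G" "s \<subseteq> bd (surf G) v"
      using ribbon_graphD(6)[OF G s] by blast
    moreover have "s' = s" if "s' \<in> segments G" "x \<in> s'" for s'
      using disj s x(1) that by (metis pairwiseD disjnt_iff)
    ultimately show ?thesis
      using x segments_nonempty(2)[OF s] by auto
  qed
  have arrow: "\<exists>t h. directed (\<phi> e) s t h \<and> t \<in> s \<and> h \<in> s \<and> t \<noteq> h \<and>
      t \<in> topspace (rest_space G) \<and> h \<in> topspace (rest_space G)"
    if s: "s \<in> segments G" "s \<subseteq> e" for s
  proof -
    obtain t h where th: "directed (\<phi> e) s t h"
      using directed_exists[OF or_e segment_subset_bd_edge[OF G s(1) e s(2)] ribbon_graphD(5)[OF G s(1)]]
      by blast
    note ends = directed_ends[OF inj th] directed_seg_ends[OF ribbon_graphD(1)[OF G] or_e th]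
    show ?thesis
      by (intro exI[of _ t] exI[of _ h] conjI in_rest[OF s(1)] th ends)
  qed
  obtain s1 s2 where s12: "{s \<in> segments G. s \<subseteq> e} = {s1, s2}" "s1 \<noteq> s2"
    using ribbon_graphD(8)[OF G e] by (auto simp: card_2_iff)
  then have s: "s1 \<in> segments G" "s1 \<subseteq> e" "s2 \<in> segments G" "s2 \<subseteq> e"
    by blast+
  have s1s2: "s1 \<inter> s2 = {}"
    using disj s s12(2) by (metis pairwiseD disjnt_def)
  obtain t1 h1 where 1: "directed (\<phi> e) s1 t1 h1" "t1 \<in> s1" "h1 \<in> s1" "t1 \<noteq> h1"
      "t1 \<in> topspace (rest_space G)" "h1 \<in> topspace (rest_space G)"
    using arrow[OF s(1,2)] by blast
  obtain t2 h2 where 2: "directed (\<phi> e) s2 t2 h2" "t2 \<in> s2" "h2 \<in> s2" "t2 \<noteq> h2"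
      "t2 \<in> topspace (rest_space G)" "h2 \<in> topspace (rest_space G)"
    using arrow[OF s(3,4)] by blast
  have "edge_arrows G \<phi> e = {(t, h). \<exists>s\<in>{s1, s2}. directed (\<phi> e) s t h}"
    unfolding s12(1)[symmetric] by blast
  moreover have "directed (\<phi> e) s1 t h \<longleftrightarrow> t = t1 \<and> h = h1"
    "directed (\<phi> e) s2 t h \<longleftrightarrow> t = t2 \<and> h = h2" for t h
    using directed_unique[OF inj] 1(1) 2(1) by metis+
  ultimately have "edge_arrows G \<phi> e = {(t1, h1), (t2, h2)}"
    by auto
  moreover have "distinct [t1, h1, t2, h2]"
    using 1(2-4) 2(2-4) s1s2 by auto
  ultimately show ?thesis
    using 1(5,6) 2(5,6) two_arrowsI[of t1 h1 t2 h2] by simp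
qed

text \<open>The inclusions coming from the comparison of orientations are equalities, since both sides
  have two elements.\<close>

lemma edge_arrows_orientations:
  assumes G: "ribbon_graph G" and \<phi>: "orientations G \<phi>" and \<psi>: "orientations G \<psi>" and e: "e \<in> edges G"
  shows "edge_arrows G \<psi> e = edge_arrows G \<phi> e \<or> edge_arrows G \<psi> e = prod.swap ` edge_arrows G \<phi> e"
proof -
  note two\<phi> = two_arrows_edge_arrows[OF G \<phi> e]
  have eqI: "edge_arrows G \<psi> e = A"
    if A: "two_arrows (topspace (rest_space G)) A" and sub: "edge_arrows G \<psi> e \<subseteq> A" for A
    using two_arrows_card[OF A] two_arrows_card[OF two_arrows_edge_arrows[OF G \<psi> e]] sub
    by (intro card_subset_eq) auto
  have "edge_arrows G \<psi> e \<subseteq> edge_arrows G \<phi> e \<or> edge_arrows G \<psi> e \<subseteq> prod.swap ` edge_arrows G \<phi> e"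
  proof -
    have "orientation (surf G) e (\<phi> e)" "orientation (surf G) e (\<psi> e)"
      using \<phi> \<psi> e by (simp_all add: orientations_def)
    from orientations_agree_or_opposite[OF this] show ?thesis
    proof
      assume "\<forall>s t h. directed (\<psi> e) s t h \<longrightarrow> directed (\<phi> e) s t h"
      then have "edge_arrows G \<psi> e \<subseteq> edge_arrows G \<phi> e"
        by blast
      then show ?thesis ..
    next
      assume opp: "\<forall>s t h. directed (\<psi> e) s t h \<longrightarrow> directed (\<phi> e) s h t"
      have "p \<in> prod.swap ` edge_arrows G \<phi> e" if "p \<in> edge_arrows G \<psi> e" for p
      proof (rule image_eqI)
        show "p = prod.swap (prod.swap p)" by simp
        show "prod.swap p \<in> edge_arrows G \<phi> e"
          using that opp by (cases p) auto
      qed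
      then show ?thesis by blast
    qed
  qed
  then show ?thesis
    using eqI[OF two\<phi>] eqI[OF two_arrows_swap[OF two\<phi>]] by (elim disjE) simp_all
qed

section \<open>Transport along isomorphisms of ribbon graphs\<close>

lemma homeomorphic_map_restrict:
  assumes "homeomorphic_map X Y F" "d \<subseteq> topspace X"
  shows "homeomorphic_map (subtopology X d) (subtopology Y (F ` d)) F"
  using assms homeomorphic_imp_surjective_map[OF assms(1)]
  by (intro homeomorphic_map_subtopologies) (auto simp: Int_absorb1 image_mono)

lemma image_bd_subset:
  assumes "homeomorphic_map X Y F" "d \<subseteq> topspace X"
  shows "F ` bd X d \<subseteq> bd Y (F ` d)"
proof
  fix y
  assume "y \<in> F ` bd X d"
  then obtain f x where f: "homeomorphic_map (top_of_set (cball (0 :: complex) 1)) (subtopology X d) f"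
    and x: "x \<in> sphere 0 1" "y = F (f x)"
    unfolding bd_def by blast
  from f homeomorphic_map_restrict[OF assms]
  have "homeomorphic_map (top_of_set (cball (0 :: complex) 1)) (subtopology Y (F ` d)) (F \<circ> f)"
    by (rule homeomorphic_map_compose)
  moreover have "y \<in> (F \<circ> f) ` sphere 0 1"
    using x by simp
  ultimately show "y \<in> bd Y (F ` d)"
    unfolding bd_def by blast
qed

lemma image_seg_ends_subset:
  assumes "homeomorphic_map X Y F" "s \<subseteq> topspace X"
  shows "F ` seg_ends X s \<subseteq> seg_ends Y (F ` s)"
proof
  fix y
  assume "y \<in> F ` seg_ends X s"
  then obtain f where f: "homeomorphic_map (top_of_set {0..1 :: real}) (subtopology X s) f"
    and y: "y = F (f 0)"
    unfolding seg_ends_def by blast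
  from f homeomorphic_map_restrict[OF assms]
  have "homeomorphic_map (top_of_set {0..1 :: real}) (subtopology Y (F ` s)) (F \<circ> f)"
    by (rule homeomorphic_map_compose)
  then show "y \<in> seg_ends Y (F ` s)"
    unfolding seg_ends_def using y by (intro CollectI exI[of _ "F \<circ> f"]) simp
qed

lemma seg_ends_subset: "seg_ends X s \<subseteq> topspace X \<inter> s"
proof
  fix x
  assume "x \<in> seg_ends X s"
  then obtain f where f: "homeomorphic_map (top_of_set {0..1 :: real}) (subtopology X s) f" "x = f 0"
    unfolding seg_ends_def by blast
  have "f ` {0..1} = topspace X \<inter> s"
    using homeomorphic_imp_surjective_map[OF f(1)] by simp
  then show "x \<in> topspace X \<inter> s"
    using f(2) by (metis atLeastAtMost_iff image_eqI order_refl zero_le_one)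
qed

lemma image_bd:
  assumes "homeomorphic_map X Y F" "d \<subseteq> topspace X"
  shows "bd Y (F ` d) = F ` bd X d"
proof
  obtain F' where F': "homeomorphic_map Y X F'"
    "\<forall>x\<in>topspace X. F' (F x) = x" "\<forall>y\<in>topspace Y. F (F' y) = y"
    by (rule homeomorphic_map_inverseE[OF assms(1)])
  have Fd: "F ` d \<subseteq> topspace Y"
    using homeomorphic_imp_surjective_map[OF assms(1)] assms(2) by blast
  have "F' ` F ` d = d"
    using F'(2) assms(2) by force
  then have "F' ` bd Y (F ` d) \<subseteq> bd X d"
    using image_bd_subset[OF F'(1) Fd] by simp
  then have "F ` F' ` bd Y (F ` d) \<subseteq> F ` bd X d"
    by (rule image_mono)
  moreover have "F ` F' ` bd Y (F ` d) = bd Y (F ` d)"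
  proof -
    have "F (F' y) = y" if "y \<in> bd Y (F ` d)" for y
      using F'(3) bd_subset[of Y "F ` d"] that by blast
    then show ?thesis
      by (simp add: image_comp)
  qed
  ultimately show "bd Y (F ` d) \<subseteq> F ` bd X d" by simp
qed (rule image_bd_subset[OF assms])

lemma image_seg_ends:
  assumes "homeomorphic_map X Y F" "s \<subseteq> topspace X"
  shows "seg_ends Y (F ` s) = F ` seg_ends X s"
proof
  obtain F' where F': "homeomorphic_map Y X F'"
    "\<forall>x\<in>topspace X. F' (F x) = x" "\<forall>y\<in>topspace Y. F (F' y) = y"
    by (rule homeomorphic_map_inverseE[OF assms(1)])
  have Fs: "F ` s \<subseteq> topspace Y"
    using homeomorphic_imp_surjective_map[OF assms(1)] assms(2) by blast
  have "F' ` F ` s = s"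
    using F'(2) assms(2) by force
  then have "F' ` seg_ends Y (F ` s) \<subseteq> seg_ends X s"
    using image_seg_ends_subset[OF F'(1) Fs] by simp
  then have "F ` F' ` seg_ends Y (F ` s) \<subseteq> F ` seg_ends X s"
    by (rule image_mono)
  moreover have "F ` F' ` seg_ends Y (F ` s) = seg_ends Y (F ` s)"
  proof -
    have "F (F' y) = y" if "y \<in> seg_ends Y (F ` s)" for y
      using F'(3) seg_ends_subset[of Y "F ` s"] that by blast
    then show ?thesis
      by (simp add: image_comp)
  qed
  ultimately show "seg_ends Y (F ` s) \<subseteq> F ` seg_ends X s" by simp
qed (rule image_seg_ends_subset[OF assms])

lemma segments_image:
  assumes iso: "ribbon_iso G H F" and G: "ribbon_graph G"
  shows "segments H = (`) F ` segments G"
proof -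
  have hom: "homeomorphic_map (surf G) (surf H) F" and
    H: "verts H = (`) F ` verts G" "edges H = (`) F ` edges G"
    using iso by (auto simp: ribbon_iso_def)
  have "connected_components_of (subtopology (surf H) (F ` v \<inter> F ` e)) =
      (`) F ` connected_components_of (subtopology (surf G) (v \<inter> e))"
    if "v \<in> verts G" "e \<in> edges G" for v e
  proof -
    have sub: "v \<subseteq> topspace (surf G)" "e \<subseteq> topspace (surf G)"
      using ribbon_graphD(2)[OF G] that by auto
    then have "F ` v \<inter> F ` e = F ` (v \<inter> e)"
      using inj_on_image_Int[OF homeomorphic_imp_injective_map[OF hom]] by simp
    moreover have "homeomorphic_map (subtopology (surf G) (v \<inter> e)) (subtopology (surf H) (F ` (v \<inter> e))) F"
      using sub by (intro homeomorphic_map_restrict[OF hom]) auto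
    ultimately show ?thesis
      using homeomorphic_map_connected_components_of by metis
  qed
  then show ?thesis
    by (simp add: segments_def H image_UN)
qed

lemma rest_space_image:
  assumes iso: "ribbon_iso G H F" and G: "ribbon_graph G"
  shows "homeomorphic_map (rest_space G) (rest_space H) F"
proof -
  have hom: "homeomorphic_map (surf G) (surf H) F" and
    H: "verts H = (`) F ` verts G" "edges H = (`) F ` edges G"
    using iso by (auto simp: ribbon_iso_def)
  note inj = homeomorphic_imp_injective_map[OF hom]
  have bdv: "bd (surf H) (F ` v) = F ` bd (surf G) v" if "v \<in> verts G" for v
    using ribbon_graphD(2)[OF G] that by (intro image_bd[OF hom]) auto
  have ends: "F ` s - seg_ends (surf H) (F ` s) = F ` (s - seg_ends (surf G) s)"
    if "s \<in> segments G" for s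
  proof -
    have s: "s \<subseteq> topspace (surf G)"
      by (rule segments_nonempty(2)[OF that])
    show ?thesis
      unfolding image_seg_ends[OF hom s] using s seg_ends_subset[of "surf G" s]
      by (intro inj_on_image_set_diff[OF inj, symmetric]) auto
  qed
  have V: "(\<Union>v\<in>verts H. bd (surf H) v) = F ` (\<Union>v\<in>verts G. bd (surf G) v)"
    by (simp add: H(1) bdv image_UN)
  have S: "(\<Union>s\<in>segments H. s - seg_ends (surf H) s) = F ` (\<Union>s\<in>segments G. s - seg_ends (surf G) s)"
    by (simp add: segments_image[OF assms] ends image_UN)
  have sub: "(\<Union>v\<in>verts G. bd (surf G) v) \<subseteq> topspace (surf G)"
    using bd_subset[of "surf G"] by blast
  have "(\<Union>s\<in>segments G. s - seg_ends (surf G) s) \<subseteq> topspace (surf G)"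
    using segments_nonempty(2) by fastforce
  then show ?thesis
    unfolding V S using sub
    by (subst inj_on_image_set_diff[OF inj, symmetric]) (auto intro!: homeomorphic_map_restrict[OF hom])
qed

lemma orientation_image:
  assumes hom: "homeomorphic_map X Y F" and e: "e \<subseteq> topspace X" and \<phi>: "orientation X e \<phi>"
  shows "orientation Y (F ` e) (F \<circ> \<phi>)"
proof -
  have "bd X e \<subseteq> topspace X"
    using bd_subset[of X e] by simp
  from homeomorphic_map_restrict[OF hom this]
  have "homeomorphic_map (subtopology X (bd X e)) (subtopology Y (bd Y (F ` e))) F"
    by (simp add: image_bd[OF hom e])
  with \<phi> show ?thesis
    unfolding orientation_def by (rule homeomorphic_map_compose)
qed

text \<open>Apart from the orientation of the edge, its arrows are defined by topological data, which an
  isomorphism preserves; the assumption on \<open>\<psi>\<close> carries the orientation over as well.\<close>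

lemma edge_arrows_image:
  assumes iso: "ribbon_iso G H F" and G: "ribbon_graph G" and e: "e \<in> edges G"
    and \<phi>: "orientation (surf G) e (\<phi> e)" and \<psi>: "\<psi> (F ` e) = F \<circ> \<phi> e"
  shows "edge_arrows H \<psi> (F ` e) = map_prod F F ` edge_arrows G \<phi> e"
proof -
  have hom: "homeomorphic_map (surf G) (surf H) F"
    using iso by (auto simp: ribbon_iso_def)
  note inj = homeomorphic_imp_injective_map[OF hom]
  have e_sub: "e \<subseteq> topspace (surf G)"
    using ribbon_graphD(2)[OF G] e by auto
  have \<phi>_sub: "\<phi> e ` cis ` A \<subseteq> topspace (surf G)" for A
    using orientation_facts(2)[OF \<phi>] bd_subset[of "surf G" e] by auto
  show ?thesis
  proof (intro equalityI subsetI)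
    fix p
    assume "p \<in> edge_arrows H \<psi> (F ` e)"
    then obtain s a b where s: "s \<in> segments G" "F ` s \<subseteq> F ` e" and
      ab: "a < b" "b < a + 2 * pi" "F ` s = F ` \<phi> e ` cis ` {a..b}" and
      p: "p = (F (\<phi> e (cis a)), F (\<phi> e (cis b)))"
      unfolding directed_def \<psi> segments_image[OF iso G] by (auto simp: image_comp)
    note s_sub = segments_nonempty(2)[OF s(1)]
    have "s = \<phi> e ` cis ` {a..b}"
      using ab(3) inj_on_image_eq_iff[OF inj s_sub \<phi>_sub] by blast
    then have "directed (\<phi> e) s (\<phi> e (cis a)) (\<phi> e (cis b))"
      unfolding directed_def using ab by blast
    moreover have "s \<subseteq> e"
      using s(2) inj_on_image_subset_iff[OF inj s_sub e_sub] by blast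
    ultimately have "(\<phi> e (cis a), \<phi> e (cis b)) \<in> edge_arrows G \<phi> e"
      using s(1) by blast
    then show "p \<in> map_prod F F ` edge_arrows G \<phi> e"
      unfolding p by (rule map_prod_imageI)
  next
    fix p
    assume "p \<in> map_prod F F ` edge_arrows G \<phi> e"
    then obtain s a b where s: "s \<in> segments G" "s \<subseteq> e" and
      ab: "a < b" "b < a + 2 * pi" "s = \<phi> e ` cis ` {a..b}" and
      p: "p = (F (\<phi> e (cis a)), F (\<phi> e (cis b)))"
      unfolding directed_def by auto
    have "F ` s = (F \<circ> \<phi> e) ` cis ` {a..b}"
      by (simp add: ab(3) image_comp)
    then have "directed (\<psi> (F ` e)) (F ` s) (F (\<phi> e (cis a))) (F (\<phi> e (cis b)))"
      unfolding directed_def \<psi> using ab(1,2)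
      by (intro exI[of _ a] exI[of _ b]) simp
    moreover have "F ` s \<in> segments H" "F ` s \<subseteq> F ` e"
      unfolding segments_image[OF iso G] using s by (auto intro: image_mono)
    ultimately show "p \<in> edge_arrows H \<psi> (F ` e)"
      unfolding p by blast
  qed
qed

section \<open>Relating ordered graphs by classes of words\<close>

text \<open>Ordered twisted duality, indexed by positions instead of edges. The class at an edge is applied
  to the arrows of that edge, and the result is compared with the target through a
  homeomorphism \<open>f\<close> of the rest spaces, which is the same for all edges.\<close>

definition twist_related ::
  "nat \<Rightarrow> (nat \<Rightarrow> twual list set) \<Rightarrow> 'a ribbon \<times> (nat \<Rightarrow> 'a set) \<Rightarrow> 'a ribbon \<times> (nat \<Rightarrow> 'a set) \<Rightarrow> bool" where
  "twist_related n c = (\<lambda>(G, l) (K, k).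
     (G, l) \<in> ordered_graphs n \<and> (K, k) \<in> ordered_graphs n \<and>
     (\<exists>\<phi> \<psi> f. orientations G \<phi> \<and> orientations K \<psi> \<and>
        homeomorphic_map (rest_space G) (rest_space K) f \<and>
        (\<forall>i\<in>{1..n}. \<exists>T. class_acts (c i) (edge_arrows G \<phi> (l i)) T \<and>
           edge_arrows K \<psi> (k i) = map_prod f f ` T)))"

lemma twist_relatedI:
  assumes "(G, l) \<in> ordered_graphs n" "(K, k) \<in> ordered_graphs n"
    "orientations G \<phi>" "orientations K \<psi>"
    "homeomorphic_map (rest_space G) (rest_space K) f"
    "\<And>i. i \<in> {1..n} \<Longrightarrow> class_acts (c i) (edge_arrows G \<phi> (l i)) (T i)"
    "\<And>i. i \<in> {1..n} \<Longrightarrow> edge_arrows K \<psi> (k i) = map_prod f f ` T i"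
  shows "twist_related n c (G, l) (K, k)"
proof -
  have "\<forall>i\<in>{1..n}. \<exists>T. class_acts (c i) (edge_arrows G \<phi> (l i)) T \<and>
      edge_arrows K \<psi> (k i) = map_prod f f ` T"
  proof
    fix i
    assume i: "i \<in> {1..n}"
    show "\<exists>T. class_acts (c i) (edge_arrows G \<phi> (l i)) T \<and> edge_arrows K \<psi> (k i) = map_prod f f ` T"
      by (intro exI[of _ "T i"] conjI assms(6,7)[OF i])
  qed
  then have "\<exists>\<phi> \<psi> f. orientations G \<phi> \<and> orientations K \<psi> \<and>
      homeomorphic_map (rest_space G) (rest_space K) f \<and>
      (\<forall>i\<in>{1..n}. \<exists>T. class_acts (c i) (edge_arrows G \<phi> (l i)) T \<and>
        edge_arrows K \<psi> (k i) = map_prod f f ` T)"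
    by (intro exI[of _ \<phi>] exI[of _ \<psi>] exI[of _ f] conjI assms(3-5))
  then show ?thesis
    unfolding twist_related_def prod.case by (intro conjI assms(1,2))
qed

lemma twist_relatedE:
  assumes "twist_related n c (G, l) (K, k)"
  obtains \<phi> \<psi> f T where "orientations G \<phi>" "orientations K \<psi>"
    "homeomorphic_map (rest_space G) (rest_space K) f"
    "\<forall>i\<in>{1..n}. class_acts (c i) (edge_arrows G \<phi> (l i)) (T i)"
    "\<forall>i\<in>{1..n}. edge_arrows K \<psi> (k i) = map_prod f f ` T i"
proof -
  from assms obtain \<phi> \<psi> f where or: "orientations G \<phi>" "orientations K \<psi>"
    "homeomorphic_map (rest_space G) (rest_space K) f" and
    ex: "\<forall>i\<in>{1..n}. \<exists>T. class_acts (c i) (edge_arrows G \<phi> (l i)) T \<and>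
           edge_arrows K \<psi> (k i) = map_prod f f ` T"
    unfolding twist_related_def prod.case by (elim conjE exE)
  from bchoice[OF ex] obtain T where
    T: "\<forall>i\<in>{1..n}. class_acts (c i) (edge_arrows G \<phi> (l i)) (T i) \<and>
           edge_arrows K \<psi> (k i) = map_prod f f ` T i" ..
  show thesis
    by (rule that[OF or, of T]) (use T in blast)+
qed

lemma twist_related_ordered_graphs:
  assumes "twist_related n c (G, l) (K, k)"
  shows "(G, l) \<in> ordered_graphs n" "(K, k) \<in> ordered_graphs n"
  using assms unfolding twist_related_def by simp_all

lemma ordered_graphsD:
  assumes "(G, l) \<in> ordered_graphs n"
  shows "ribbon_graph G" "bij_betw l {1..n} (edges G)" "i \<in> {1..n} \<Longrightarrow> l i \<in> edges G"
  using assms by (auto simp: ordered_graphs_def dest: bij_betwE)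

lemma twisted_dual_iff_twist_related:
  assumes G: "(G, l) \<in> ordered_graphs n" and K: "(K, k) \<in> ordered_graphs n"
  shows "(\<exists>g. twisted_dual (\<lambda>e. c (inv_into {1..n} l e)) G K g \<and> (\<forall>i\<in>{1..n}. k i = g (l i))) \<longleftrightarrow>
         twist_related n c (G, l) (K, k)"
proof
  assume "\<exists>g. twisted_dual (\<lambda>e. c (inv_into {1..n} l e)) G K g \<and> (\<forall>i\<in>{1..n}. k i = g (l i))"
  then obtain g \<phi> \<psi> Q f where
    or: "orientations G \<phi>" "orientations K \<psi>" and
    Q: "apply_ops (\<lambda>e. c (inv_into {1..n} l e)) (presentation G \<phi>) Q" and
    k: "\<forall>i\<in>{1..n}. k i = g (l i)" and
    f: "homeomorphic_map (rest Q) (rest_space K) f" and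
    arr: "\<forall>e\<in>labels Q. edge_arrows K \<psi> (g e) = map_prod f f ` arrows Q e"
    unfolding twisted_dual_def ap_iso_def presentation_def arrow_presentation.simps by (elim exE conjE)
  have rest: "rest Q = rest_space G" "labels Q = edges G"
    using Q by (auto simp: apply_ops_def presentation_def)
  have main: "class_acts (c i) (edge_arrows G \<phi> (l i)) (arrows Q (l i)) \<and>
      edge_arrows K \<psi> (k i) = map_prod f f ` arrows Q (l i)" if i: "i \<in> {1..n}" for i
  proof -
    have "inv_into {1..n} l (l i) = i"
      using ordered_graphsD(2)[OF G] i by (simp add: bij_betw_def)
    moreover have "\<forall>e\<in>edges G. \<exists>w\<in>c (inv_into {1..n} l e). twual_word w (edge_arrows G \<phi> e) (arrows Q e)"
      using Q unfolding apply_ops_def presentation_def arrow_presentation.simps by (elim conjE)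
    from bspec[OF this ordered_graphsD(3)[OF G i]]
    have "class_acts (c (inv_into {1..n} l (l i))) (edge_arrows G \<phi> (l i)) (arrows Q (l i))"
      unfolding class_acts_def .
    ultimately have "class_acts (c i) (edge_arrows G \<phi> (l i)) (arrows Q (l i))"
      by (simp only:)
    then show ?thesis
      using arr k i rest(2) ordered_graphsD(3)[OF G i] by simp
  qed
  show "twist_related n c (G, l) (K, k)"
    by (rule twist_relatedI[OF G K or f[unfolded rest(1)], where T = "\<lambda>i. arrows Q (l i)"])
      (erule main[THEN conjunct1], erule main[THEN conjunct2])
next
  assume "twist_related n c (G, l) (K, k)"
  then obtain \<phi> \<psi> f T where
    or: "orientations G \<phi>" "orientations K \<psi>" and
    f: "homeomorphic_map (rest_space G) (rest_space K) f" and
    acts_T: "\<forall>i\<in>{1..n}. class_acts (c i) (edge_arrows G \<phi> (l i)) (T i)" and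
    eq_T: "\<forall>i\<in>{1..n}. edge_arrows K \<psi> (k i) = map_prod f f ` T i"
    by (rule twist_relatedE)
  note T = bspec[OF acts_T] bspec[OF eq_T]
  let ?j = "inv_into {1..n} l"
  let ?Q = "\<lparr>rest = rest_space G, labels = edges G, arrows = \<lambda>e. T (?j e)\<rparr>"
  have bij: "bij_betw ?j (edges G) {1..n}"
    by (rule bij_betw_inv_into[OF ordered_graphsD(2)[OF G]])
  have j: "?j e \<in> {1..n}" "l (?j e) = e" if "e \<in> edges G" for e
    using that bij bij_betw_inv_into_right[OF ordered_graphsD(2)[OF G]] by (auto dest: bij_betwE)
  have "apply_ops (\<lambda>e. c (?j e)) (presentation G \<phi>) ?Q"
    unfolding apply_ops_def presentation_def using T(1)[OF j(1)] j(2)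
    by (auto simp: class_acts_def)
  moreover have "ap_iso (k \<circ> ?j) ?Q (presentation K \<psi>)"
    unfolding ap_iso_def presentation_def
    using bij_betw_trans[OF bij ordered_graphsD(2)[OF K]] f T(2)[OF j(1)] by auto
  ultimately have "twisted_dual (\<lambda>e. c (?j e)) G K (k \<circ> ?j)"
    unfolding twisted_dual_def using or by blast
  moreover have "k i = (k \<circ> ?j) (l i)" if "i \<in> {1..n}" for i
    using ordered_graphsD(2)[OF G] that by (simp add: bij_betw_def)
  ultimately show "\<exists>g. twisted_dual (\<lambda>e. c (?j e)) G K g \<and> (\<forall>i\<in>{1..n}. k i = g (l i))"
    by blast
qed

lemma ordered_graphs_permute:
  assumes "(G, l) \<in> ordered_graphs n" "\<sigma> permutes {1..n}"
  shows "(G, l \<circ> \<sigma>) \<in> ordered_graphs n"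
  using assms bij_betw_trans[OF permutes_imp_bij] by (auto simp: ordered_graphs_def)

lemma mem_act_iff:
  assumes C: "C \<subseteq> ordered_graphs n" and \<pi>: "\<pi> permutes {1..n}"
  shows "y \<in> act n (c, \<pi>) C \<longleftrightarrow>
    (\<exists>(G, l)\<in>C. twist_related n c (G, l \<circ> inv_into UNIV \<pi>) y)"
proof -
  obtain K k where y: "y = (K, k)" by (cases y)
  have perm: "(G, l \<circ> inv_into UNIV \<pi>) \<in> ordered_graphs n" if "(G, l) \<in> C" for G l
    using that C ordered_graphs_permute permutes_inv[OF \<pi>] by blast
  have "y \<in> act n (c, \<pi>) C \<longleftrightarrow> (K, k) \<in> ordered_graphs n \<and> (\<exists>(G, l)\<in>C. \<exists>g.
      twisted_dual (\<lambda>e. c (inv_into {1..n} (l \<circ> inv_into UNIV \<pi>) e)) G K g \<and>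
      (\<forall>i\<in>{1..n}. k i = g ((l \<circ> inv_into UNIV \<pi>) i)))"
    by (simp add: act_def y)
  also have "\<dots> \<longleftrightarrow> (\<exists>(G, l)\<in>C. twist_related n c (G, l \<circ> inv_into UNIV \<pi>) y)"
  proof
    assume "(K, k) \<in> ordered_graphs n \<and> (\<exists>(G, l)\<in>C. \<exists>g.
      twisted_dual (\<lambda>e. c (inv_into {1..n} (l \<circ> inv_into UNIV \<pi>) e)) G K g \<and>
      (\<forall>i\<in>{1..n}. k i = g ((l \<circ> inv_into UNIV \<pi>) i)))"
    then show "\<exists>(G, l)\<in>C. twist_related n c (G, l \<circ> inv_into UNIV \<pi>) y"
      using twisted_dual_iff_twist_related[OF perm] y by fast
  next
    assume "\<exists>(G, l)\<in>C. twist_related n c (G, l \<circ> inv_into UNIV \<pi>) y"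
    then obtain G l where Gl: "(G, l) \<in> C" "twist_related n c (G, l \<circ> inv_into UNIV \<pi>) (K, k)"
      using y by blast
    have "(K, k) \<in> ordered_graphs n"
      by (rule twist_related_ordered_graphs(2)[OF Gl(2)])
    with Gl show "(K, k) \<in> ordered_graphs n \<and> (\<exists>(G, l)\<in>C. \<exists>g.
      twisted_dual (\<lambda>e. c (inv_into {1..n} (l \<circ> inv_into UNIV \<pi>) e)) G K g \<and>
      (\<forall>i\<in>{1..n}. k i = g ((l \<circ> inv_into UNIV \<pi>) i)))"
      using twisted_dual_iff_twist_related[OF perm[OF Gl(1)]] by fast
  qed
  finally show ?thesis .
qed

lemma map_prod_inverse_image:
  assumes "two_arrows V S" "\<And>x. x \<in> V \<Longrightarrow> g (f x) = x"
  shows "map_prod g g ` map_prod f f ` S = S"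
proof -
  have "map_prod g g (map_prod f f p) = p" if "p \<in> S" for p
    using that two_arrows_imp_subset[OF assms(1)] assms(2) by (cases p) auto
  then show ?thesis
    by (simp add: image_comp)
qed

text \<open>The two relations may use different orientations \<open>\<psi>\<close> and \<open>\<psi>'\<close> of the edges in the middle.
  The resulting reversal of arrows is absorbed by the second class. The second operation is then
  pulled back along the first homeomorphism, so that both take place on the same rest space.\<close>

lemma twist_related_trans:
  assumes GK: "twist_related n c (G, l) (K, k)" and KL: "twist_related n d (K, k) (L, m)"
    and c: "\<And>i. i \<in> {1..n} \<Longrightarrow> d i \<in> carrier twuality"
  shows "twist_related n (\<lambda>i. d i \<otimes>\<^bsub>twuality\<^esub> c i) (G, l) (L, m)"
proof -
  have G: "(G, l) \<in> ordered_graphs n" and K: "(K, k) \<in> ordered_graphs n" and L: "(L, m) \<in> ordered_graphs n"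
    using GK KL twist_related_ordered_graphs by blast+
  obtain \<phi> \<psi> f T where \<phi>: "orientations G \<phi>" and \<psi>: "orientations K \<psi>" and
    f: "homeomorphic_map (rest_space G) (rest_space K) f" and
    acts_T: "\<forall>i\<in>{1..n}. class_acts (c i) (edge_arrows G \<phi> (l i)) (T i)" and
    eq_T: "\<forall>i\<in>{1..n}. edge_arrows K \<psi> (k i) = map_prod f f ` T i"
    by (rule twist_relatedE[OF GK])
  note T = bspec[OF acts_T] bspec[OF eq_T]
  obtain \<psi>' \<omega> h U where \<psi>': "orientations K \<psi>'" and \<omega>: "orientations L \<omega>" and
    h: "homeomorphic_map (rest_space K) (rest_space L) h" and
    acts_U: "\<forall>i\<in>{1..n}. class_acts (d i) (edge_arrows K \<psi>' (k i)) (U i)" and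
    eq_U: "\<forall>i\<in>{1..n}. edge_arrows L \<omega> (m i) = map_prod h h ` U i"
    by (rule twist_relatedE[OF KL])
  note U = bspec[OF acts_U] bspec[OF eq_U]
  obtain f' where f': "homeomorphic_map (rest_space K) (rest_space G) f'"
    "\<forall>x\<in>topspace (rest_space G). f' (f x) = x"
    "\<forall>y\<in>topspace (rest_space K). f (f' y) = y"
    by (rule homeomorphic_map_inverseE[OF f])
  have main: "class_acts (d i \<otimes>\<^bsub>twuality\<^esub> c i) (edge_arrows G \<phi> (l i)) (map_prod f' f' ` U i) \<and>
      edge_arrows L \<omega> (m i) = map_prod (h \<circ> f) (h \<circ> f) ` map_prod f' f' ` U i" if i: "i \<in> {1..n}" for i
  proof -
    note l = ordered_graphsD(3)[OF G i] and k = ordered_graphsD(3)[OF K i]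
    note two_G = two_arrows_edge_arrows[OF ordered_graphsD(1)[OF G] \<phi> l]
    note two_K = two_arrows_edge_arrows[OF ordered_graphsD(1)[OF K] \<psi> k]
    note two_K' = two_arrows_edge_arrows[OF ordered_graphsD(1)[OF K] \<psi>' k]
    have "edge_arrows K \<psi> (k i) = edge_arrows K \<psi>' (k i) \<or>
        edge_arrows K \<psi> (k i) = prod.swap ` edge_arrows K \<psi>' (k i)"
      by (rule edge_arrows_orientations[OF ordered_graphsD(1)[OF K] \<psi>' \<psi> k])
    then have "class_acts (d i) (edge_arrows K \<psi> (k i)) (U i)"
      using U(1)[OF i] class_acts_swap[OF c[OF i] two_K' U(1)[OF i]] by auto
    then have "class_acts (d i) (map_prod f' f' ` edge_arrows K \<psi> (k i)) (map_prod f' f' ` U i)"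
      using class_acts_map[OF two_K homeomorphic_imp_injective_map[OF f'(1)]] by blast
    moreover have "two_arrows (topspace (rest_space G)) (T i)"
      by (rule class_acts_two_arrows[OF two_G T(1)[OF i]])
    then have "map_prod f' f' ` edge_arrows K \<psi> (k i) = T i"
      unfolding T(2)[OF i] by (rule map_prod_inverse_image) (rule bspec[OF f'(2)])
    ultimately have act: "class_acts (d i \<otimes>\<^bsub>twuality\<^esub> c i) (edge_arrows G \<phi> (l i)) (map_prod f' f' ` U i)"
      using class_acts_mult[OF T(1)[OF i]] by (simp only:)
    have "two_arrows (topspace (rest_space K)) (U i)"
      by (rule class_acts_two_arrows[OF two_K' U(1)[OF i]])
    then have "map_prod f f ` map_prod f' f' ` U i = U i"
      by (rule map_prod_inverse_image) (rule bspec[OF f'(3)])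
    moreover have "map_prod (h \<circ> f) (h \<circ> f) ` A = map_prod h h ` map_prod f f ` A" for A
      by (simp only: image_comp map_prod.comp)
    ultimately have "map_prod (h \<circ> f) (h \<circ> f) ` map_prod f' f' ` U i = map_prod h h ` U i"
      by (simp only:)
    with act U(2)[OF i] show ?thesis
      by (simp only:)
  qed
  show ?thesis
    by (rule twist_relatedI[OF G L \<phi> \<omega> homeomorphic_map_compose[OF f h],
          where T = "\<lambda>i. map_prod f' f' ` U i"])
      (erule main[THEN conjunct1], erule main[THEN conjunct2])
qed

lemma twist_related_inv:
  assumes GK: "twist_related n c (G, l) (K, k)"
    and c: "\<And>i. i \<in> {1..n} \<Longrightarrow> c i \<in> carrier twuality"
  shows "twist_related n (\<lambda>i. inv\<^bsub>twuality\<^esub> (c i)) (K, k) (G, l)"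
proof -
  have G: "(G, l) \<in> ordered_graphs n" and K: "(K, k) \<in> ordered_graphs n"
    using GK twist_related_ordered_graphs by blast+
  obtain \<phi> \<psi> f T where \<phi>: "orientations G \<phi>" and \<psi>: "orientations K \<psi>" and
    f: "homeomorphic_map (rest_space G) (rest_space K) f" and
    acts_T: "\<forall>i\<in>{1..n}. class_acts (c i) (edge_arrows G \<phi> (l i)) (T i)" and
    eq_T: "\<forall>i\<in>{1..n}. edge_arrows K \<psi> (k i) = map_prod f f ` T i"
    by (rule twist_relatedE[OF GK])
  note T = bspec[OF acts_T] bspec[OF eq_T]
  obtain f' where f': "homeomorphic_map (rest_space K) (rest_space G) f'"
    "\<forall>x\<in>topspace (rest_space G). f' (f x) = x"
    "\<forall>y\<in>topspace (rest_space K). f (f' y) = y"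
    by (rule homeomorphic_map_inverseE[OF f])
  have main: "class_acts (inv\<^bsub>twuality\<^esub> (c i)) (edge_arrows K \<psi> (k i)) (map_prod f f ` edge_arrows G \<phi> (l i)) \<and>
      edge_arrows G \<phi> (l i) = map_prod f' f' ` map_prod f f ` edge_arrows G \<phi> (l i)"
    if i: "i \<in> {1..n}" for i
  proof -
    note two_G = two_arrows_edge_arrows[OF ordered_graphsD(1)[OF G] \<phi> ordered_graphsD(3)[OF G i]]
    have "two_arrows (topspace (rest_space G)) (T i)"
      by (rule class_acts_two_arrows[OF two_G T(1)[OF i]])
    then have "class_acts (inv\<^bsub>twuality\<^esub> (c i)) (map_prod f f ` T i) (map_prod f f ` edge_arrows G \<phi> (l i))"
      using class_acts_inv[OF c[OF i] two_G T(1)[OF i]] homeomorphic_imp_injective_map[OF f]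
      by (intro class_acts_map)
    moreover have "map_prod f' f' ` map_prod f f ` edge_arrows G \<phi> (l i) = edge_arrows G \<phi> (l i)"
      using two_G by (rule map_prod_inverse_image) (rule bspec[OF f'(2)])
    ultimately show ?thesis
      using T(2)[OF i] by simp
  qed
  show ?thesis
    by (rule twist_relatedI[OF K G \<psi> \<phi> f'(1), where T = "\<lambda>i. map_prod f f ` edge_arrows G \<phi> (l i)"])
      (erule main[THEN conjunct1], erule main[THEN conjunct2])
qed

lemma twist_related_permute:
  assumes "twist_related n c (G, l) (K, k)" "\<sigma> permutes {1..n}"
  shows "twist_related n (c \<circ> \<sigma>) (G, l \<circ> \<sigma>) (K, k \<circ> \<sigma>)"
proof -
  have \<sigma>: "\<sigma> i \<in> {1..n}" if "i \<in> {1..n}" for i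
    using permutes_in_image[OF assms(2)] that by blast
  obtain \<phi> \<psi> f T where or: "orientations G \<phi>" "orientations K \<psi>"
    "homeomorphic_map (rest_space G) (rest_space K) f" and
    T: "\<forall>i\<in>{1..n}. class_acts (c i) (edge_arrows G \<phi> (l i)) (T i)"
      "\<forall>i\<in>{1..n}. edge_arrows K \<psi> (k i) = map_prod f f ` T i"
    by (rule twist_relatedE[OF assms(1)])
  note ordered = twist_related_ordered_graphs[OF assms(1), THEN ordered_graphs_permute, OF assms(2)]
  show ?thesis
    using bspec[OF T(1) \<sigma>] bspec[OF T(2) \<sigma>]
    by (intro twist_relatedI[OF ordered or, where T = "T \<circ> \<sigma>"]) simp_all
qed

lemma twist_related_cong:
  assumes "\<And>i. i \<in> {1..n} \<Longrightarrow> c i = d i" "twist_related n c x y"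
  shows "twist_related n d x y"
  using assms unfolding twist_related_def by (auto split: prod.splits)

text \<open>Orientations of the source are transported to the target, where they produce the image
  arrows.\<close>

lemma twist_related_one_if_iso:
  assumes iso: "((G, l), (H, m)) \<in> ordered_iso n" and \<phi>: "orientations G \<phi>"
  shows "twist_related n (\<lambda>_. \<one>\<^bsub>twuality\<^esub>) (G, l) (H, m)"
proof -
  have G: "(G, l) \<in> ordered_graphs n" and H: "(H, m) \<in> ordered_graphs n"
    using iso by (auto simp: ordered_iso_def)
  obtain F where F: "ribbon_iso G H F" and m: "\<And>i. i \<in> {1..n} \<Longrightarrow> F ` l i = m i"
    using iso by (auto simp: ordered_iso_def)
  have hom: "homeomorphic_map (surf G) (surf H) F" and edges: "edges H = (`) F ` edges G"
    using F by (auto simp: ribbon_iso_def)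
  note rib = ordered_graphsD(1)[OF G]
  have sub: "e \<subseteq> topspace (surf G)" if "e \<in> edges G" for e
    using ribbon_graphD(2)[OF rib] that by auto
  have inj: "inj_on ((`) F) (edges G)"
  proof (rule inj_onI)
    fix d e
    assume "d \<in> edges G" "e \<in> edges G" "F ` d = F ` e"
    then show "d = e"
      using inj_on_image_eq_iff[OF homeomorphic_imp_injective_map[OF hom] sub sub] by simp
  qed
  define \<psi> where "\<psi> e = F \<circ> \<phi> (inv_into (edges G) ((`) F) e)" for e
  have \<psi>: "\<psi> (F ` e) = F \<circ> \<phi> e" if "e \<in> edges G" for e
    using inj that by (simp add: \<psi>_def)
  have or: "orientation (surf G) e (\<phi> e)" if "e \<in> edges G" for e
    using \<phi> that by (simp add: orientations_def)
  have "orientations H \<psi>"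
    unfolding orientations_def edges using orientation_image[OF hom sub or] \<psi> by auto
  moreover have "edge_arrows H \<psi> (m i) = map_prod F F ` edge_arrows G \<phi> (l i)" if "i \<in> {1..n}" for i
    using edge_arrows_image[of G H F "l i" \<phi> \<psi>, OF F rib _ or \<psi>] ordered_graphsD(3)[OF G that] m[OF that]
    by simp
  ultimately show ?thesis
    by (intro twist_relatedI[OF G H \<phi> _ rest_space_image[OF F rib],
          where T = "\<lambda>i. edge_arrows G \<phi> (l i)"] class_acts_one)
qed

lemma iso_class_subset: "iso_class n G l \<subseteq> ordered_graphs n"
  by (auto simp: iso_class_def ordered_iso_def)

lemma mem_own_iso_class:
  assumes "iso_class n G l \<in> G_or n"
  shows "(G, l) \<in> iso_class n G l"
proof -
  have refl: "(x, x) \<in> ordered_iso n" if "x \<in> ordered_graphs n" for x :: "'a ribbon \<times> (nat \<Rightarrow> 'a set)"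
  proof -
    obtain K k where "x = (K, k)" by (cases x)
    then show ?thesis
      using that unfolding ordered_iso_def ribbon_iso_def
      by (auto intro!: exI[of _ id] simp: image_id homeomorphic_map_id)
  qed
  from assms obtain x where x: "x \<in> ordered_graphs n" "iso_class n G l = ordered_iso n `` {x}"
    by (auto simp: G_or_def elim: quotientE)
  then have "((G, l), x) \<in> ordered_iso n"
    using refl[OF x(1)] unfolding iso_class_def by blast
  then have "(G, l) \<in> ordered_graphs n"
    by (auto simp: ordered_iso_def)
  then show ?thesis
    using refl by (simp add: iso_class_def)
qed

section \<open>Conjugating the stabilizer\<close>

theorem theorem5p4:
  fixes n :: nat
    and H G :: "'a ribbon"
    and l\<^sub>H l\<^sub>G :: "nat \<Rightarrow> 'a set"
    and \<gamma> \<alpha> :: "nat \<Rightarrow> twual list set"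
    and \<mu> \<pi> :: "nat \<Rightarrow> nat"
  assumes "n \<ge> 1"
    and "iso_class n H l\<^sub>H \<in> G_or n"
    and "\<gamma> \<in> carrier (twuality_pow n)"
    and "\<mu> permutes {1..n}"
    and "self_via n H l\<^sub>H \<gamma> \<mu>"
    and "iso_class n G l\<^sub>G \<in> G_or n"
    and "iso_class n G l\<^sub>G \<in> orbit (ordered_group n) (act n) (iso_class n H l\<^sub>H)"
    and "(\<alpha>, \<pi>) \<in> carrier (ordered_group n)"
    and "act n (\<alpha>, \<pi>) (iso_class n H l\<^sub>H) = iso_class n G l\<^sub>G"
  shows "self_via n G l\<^sub>G
     (\<alpha> \<otimes>\<^bsub>twuality_pow n\<^esub> (\<gamma> \<circ> inv_into UNIV \<pi>)
        \<otimes>\<^bsub>twuality_pow n\<^esub> (inv\<^bsub>twuality_pow n\<^esub> \<alpha> \<circ> \<pi> \<circ> inv_into UNIV \<mu> \<circ> inv_into UNIV \<pi>))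
     (\<pi> \<circ> \<mu> \<circ> inv_into UNIV \<pi>)"
proof -
  interpret tw: group twuality by (rule group_twuality)
  let ?H = "iso_class n H l\<^sub>H" and ?G = "iso_class n G l\<^sub>G"
  let ?p = "inv_into UNIV \<pi>" and ?q = "inv_into UNIV \<mu>"
  define \<gamma>' where "\<gamma>' = \<alpha> \<otimes>\<^bsub>twuality_pow n\<^esub> (\<gamma> \<circ> ?p)
        \<otimes>\<^bsub>twuality_pow n\<^esub> (inv\<^bsub>twuality_pow n\<^esub> \<alpha> \<circ> \<pi> \<circ> ?q \<circ> ?p)"
  define \<sigma> where "\<sigma> = \<pi> \<circ> ?q \<circ> ?p"
  define \<beta> where "\<beta> i = \<alpha> i \<otimes>\<^bsub>twuality\<^esub> \<gamma> (?p i)" for i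
  have \<pi>: "\<pi> permutes {1..n}" and \<mu>: "\<mu> permutes {1..n}" and
    \<alpha>: "\<alpha> \<in> (\<Pi>\<^sub>E i\<in>{1..n}. carrier twuality)"
    using assms(4,8) by (auto simp: ordered_group_def)
  have p: "?p permutes {1..n}" and q: "?q permutes {1..n}"
    using \<pi> \<mu> by (auto intro: permutes_inv)
  have \<sigma>: "\<sigma> permutes {1..n}"
    unfolding \<sigma>_def by (intro permutes_compose \<pi> p q)
  have \<pi>\<mu>: "\<pi> \<circ> \<mu> \<circ> ?p permutes {1..n}"
    by (intro permutes_compose \<pi> p \<mu>)
  have \<sigma>_inv: "inv_into UNIV (\<pi> \<circ> \<mu> \<circ> ?p) = \<sigma>"
    unfolding \<sigma>_def
    by (rule inv_unique_comp) (simp_all add: fun_eq_iff permutes_inverses[OF \<pi>] permutes_inverses[OF \<mu>])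
  have p\<sigma>: "?p \<circ> \<sigma> = ?q \<circ> ?p"
    by (simp add: \<sigma>_def fun_eq_iff permutes_inverses[OF \<pi>])
  have mem: "?p i \<in> {1..n}" "?q i \<in> {1..n}" "\<sigma> i \<in> {1..n}" if "i \<in> {1..n}" for i
    using that permutes_in_image[OF p] permutes_in_image[OF q] permutes_in_image[OF \<sigma>] by simp_all
  have \<alpha>c: "\<alpha> i \<in> carrier twuality" and \<gamma>c: "\<gamma> i \<in> carrier twuality" if "i \<in> {1..n}" for i
    using that \<alpha> assms(3) by auto
  have \<gamma>pc: "\<gamma> (?p i) \<in> carrier twuality" and \<alpha>\<sigma>c: "\<alpha> (\<sigma> i) \<in> carrier twuality"
    if "i \<in> {1..n}" for i
    using \<alpha>c \<gamma>c mem that by blast+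
  have \<beta>c: "\<beta> i \<in> carrier twuality" if "i \<in> {1..n}" for i
    unfolding \<beta>_def using that \<alpha>c \<gamma>pc by blast
  have \<gamma>': "\<gamma>' i = \<beta> i \<otimes>\<^bsub>twuality\<^esub> inv\<^bsub>twuality\<^esub> (\<alpha> (\<sigma> i))" if "i \<in> {1..n}" for i
    using that mem(3)[OF that] \<alpha> group_twuality
    by (simp add: \<gamma>'_def \<beta>_def \<sigma>_def)
  have \<gamma>'c: "\<gamma>' i \<in> carrier twuality" if "i \<in> {1..n}" for i
    using that \<gamma>' \<beta>c \<alpha>\<sigma>c by simp
  have H_self: "act n (\<gamma>, \<mu>) ?H = ?H"
    using assms(5) by (simp add: self_via_def)
  have act_H: "(K, k) \<in> ?H \<longleftrightarrow> (\<exists>(L, m)\<in>?H. twist_related n \<gamma> (L, m \<circ> ?q) (K, k))" for K k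
    using mem_act_iff[OF iso_class_subset \<mu>] H_self by metis
  have act_G: "(K, k) \<in> ?G \<longleftrightarrow> (\<exists>(L, m)\<in>?H. twist_related n \<alpha> (L, m \<circ> ?p) (K, k))" for K k
    using mem_act_iff[OF iso_class_subset \<pi>] assms(9) by metis
  have H_mem: "(H, l\<^sub>H) \<in> ?H" and G_mem: "(G, l\<^sub>G) \<in> ?G"
    using assms(2,6) by (auto intro: mem_own_iso_class)
  obtain \<phi> where \<phi>: "orientations H \<phi>"
    using H_mem act_H by (auto elim: twist_relatedE)
  have iso: "twist_related n (\<lambda>_. \<one>\<^bsub>twuality\<^esub>) (K, k) (L, m)"
    if "(K, k) \<in> ?H" "(L, m) \<in> ?H" for K k L m
  proof -
    have 1: "twist_related n (\<lambda>_. \<one>\<^bsub>twuality\<^esub>) (H, l\<^sub>H) (K, k)"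
      "twist_related n (\<lambda>_. \<one>\<^bsub>twuality\<^esub>) (H, l\<^sub>H) (L, m)"
      using that \<phi> unfolding iso_class_def by (auto intro: twist_related_one_if_iso)
    from twist_related_trans[OF twist_related_inv[OF 1(1)] 1(2)] show ?thesis by simp
  qed
  \<comment> \<open>Two members of the class of \<open>H\<close> differ by the identity class, which composes away.\<close>
  have change_source: "twist_related n c (L, m \<circ> \<tau>) (J, j)"
    if "twist_related n c (K, k \<circ> \<tau>) (J, j)" "(K, k) \<in> ?H" "(L, m) \<in> ?H" "\<tau> permutes {1..n}"
      "\<And>i. i \<in> {1..n} \<Longrightarrow> c i \<in> carrier twuality" for c K k L m J j \<tau>
    using twist_related_trans[OF twist_related_permute[OF iso[OF that(3,2)] that(4)] that(1,5)] that(5)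
    by (auto intro: twist_related_cong[rotated])
  have "(K, k) \<in> act n (\<gamma>', \<pi> \<circ> \<mu> \<circ> ?p) ?G \<longleftrightarrow> (K, k) \<in> ?G" for K k
  proof
    assume "(K, k) \<in> act n (\<gamma>', \<pi> \<circ> \<mu> \<circ> ?p) ?G"
    then obtain G1 l1 where G1: "(G1, l1) \<in> ?G" "twist_related n \<gamma>' (G1, l1 \<circ> \<sigma>) (K, k)"
      unfolding mem_act_iff[OF iso_class_subset \<pi>\<mu>] \<sigma>_inv by blast
    obtain H1 m1 where H1: "(H1, m1) \<in> ?H" "twist_related n \<alpha> (H1, m1 \<circ> ?p) (G1, l1)"
      using G1(1) unfolding act_G by blast
    obtain H0 m0 where H0: "(H0, m0) \<in> ?H" "twist_related n \<gamma> (H0, m0 \<circ> ?q) (H, l\<^sub>H)"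
      using H_mem act_H by blast
    \<comment> \<open>With \<open>\<beta>\<close> the component of the product of \<open>(\<alpha>, \<pi>)\<close> and \<open>(\<gamma>, \<mu>)\<close>, \<open>K\<close> is a \<open>\<beta>\<close>-twist of
      \<open>H1\<close>; as \<open>H\<close> is a \<open>\<gamma>\<close>-twist of \<open>H1\<close>, it follows that \<open>K\<close> is an \<open>\<alpha>\<close>-twist of \<open>H\<close>.\<close>
    have "twist_related n (\<alpha> \<circ> \<sigma>) (H1, m1 \<circ> (?q \<circ> ?p)) (G1, l1 \<circ> \<sigma>)"
      using twist_related_permute[OF H1(2) \<sigma>] by (simp add: comp_assoc p\<sigma>)
    from twist_related_trans[OF this G1(2) \<gamma>'c]
    have \<beta>: "twist_related n \<beta> (H1, m1 \<circ> (?q \<circ> ?p)) (K, k)"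
      by (rule twist_related_cong[rotated]) (simp_all add: \<gamma>' \<beta>c \<alpha>\<sigma>c tw.m_assoc)
    have "twist_related n \<gamma> (H1, m1 \<circ> ?q) (H, l\<^sub>H)"
      by (rule change_source[OF H0(2,1) H1(1) q \<gamma>c])
    from twist_related_permute[OF this p]
    have "twist_related n (\<gamma> \<circ> ?p) (H1, m1 \<circ> (?q \<circ> ?p)) (H, l\<^sub>H \<circ> ?p)"
      by (simp add: comp_assoc)
    from twist_related_trans[OF twist_related_inv[OF this] \<beta> \<beta>c]
    have "twist_related n \<alpha> (H, l\<^sub>H \<circ> ?p) (K, k)"
      by (rule twist_related_cong[rotated]) (simp_all add: \<beta>_def \<alpha>c \<gamma>pc tw.m_assoc)
    then show "(K, k) \<in> ?G"
      unfolding act_G using H_mem by blast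
  next
    assume "(K, k) \<in> ?G"
    then obtain H1 m1 where H1: "(H1, m1) \<in> ?H" "twist_related n \<alpha> (H1, m1 \<circ> ?p) (K, k)"
      unfolding act_G by blast
    obtain H0 m0 where H0: "(H0, m0) \<in> ?H" "twist_related n \<gamma> (H0, m0 \<circ> ?q) (H1, m1)"
      using H1(1) act_H by blast
    obtain H2 m2 where H2: "(H2, m2) \<in> ?H" "twist_related n \<alpha> (H2, m2 \<circ> ?p) (G, l\<^sub>G)"
      using G_mem unfolding act_G by blast
    \<comment> \<open>Both \<open>K\<close> and \<open>G\<close> are twists of \<open>H0\<close>, by \<open>\<beta>\<close> and by \<open>\<alpha>\<close>; going back to \<open>H0\<close> from \<open>G\<close> and
      on to \<open>K\<close> is the twist by \<open>\<gamma>'\<close>.\<close>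
    have "twist_related n (\<gamma> \<circ> ?p) (H0, m0 \<circ> (?q \<circ> ?p)) (H1, m1 \<circ> ?p)"
      using twist_related_permute[OF H0(2) p] by (simp add: comp_assoc)
    from twist_related_trans[OF this H1(2) \<alpha>c]
    have \<beta>: "twist_related n \<beta> (H0, m0 \<circ> (?q \<circ> ?p)) (K, k)"
      by (rule twist_related_cong[rotated]) (simp_all add: \<beta>_def)
    have "twist_related n \<alpha> (H0, m0 \<circ> ?p) (G, l\<^sub>G)"
      by (rule change_source[OF H2(2,1) H0(1) p \<alpha>c])
    from twist_related_permute[OF this \<sigma>]
    have "twist_related n (\<alpha> \<circ> \<sigma>) (H0, m0 \<circ> (?q \<circ> ?p)) (G, l\<^sub>G \<circ> \<sigma>)"
      by (simp add: comp_assoc p\<sigma>)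
    from twist_related_trans[OF twist_related_inv[OF this] \<beta> \<beta>c]
    have "twist_related n \<gamma>' (G, l\<^sub>G \<circ> \<sigma>) (K, k)"
      by (rule twist_related_cong[rotated]) (simp_all add: \<gamma>' \<alpha>\<sigma>c)
    then show "(K, k) \<in> act n (\<gamma>', \<pi> \<circ> \<mu> \<circ> ?p) ?G"
      unfolding mem_act_iff[OF iso_class_subset \<pi>\<mu>] \<sigma>_inv using G_mem by blast
  qed
  then show ?thesis
    unfolding self_via_def \<gamma>'_def[symmetric] by auto
qed

end
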